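(* Let $T:\mathcal{S}(\mathbb{R}^n)\to\mathcal{S}(\mathbb{R}^n)$ be a bijection satisfying the following conditions for all functions $f,g\in\mathcal{S}(\mathbb{R}^n)$: (a) $T(f+\overline{g}) = T(f)+[T(g)]^*$, where $[Tg]^*(x)=\overline{Tg(-x)}$ for $x\in\mathbb{R}^n$; (b) $T(f\cdot g)=T(f)\ast T(g)$; (c) $T(f\ast g)=T(f)\cdot T(g)$. Then there exists a matrix $B\in GL(n,\mathbb{R})$ with $|\det B|=1$ such that either $Tf=\mathcal{F}(f\circ B)$ for all $f\in\mathcal{S}(\mathbb{R}^n)$, or $Tf=\mathcal{F}(\overline{f\circ B})$ for all $f\in\mathcal{S}(\mathbb{R}^n)$.
   Context: $\mathcal{S}(\mathbb{R}^n)$ is the Schwartz space of functions $f:\mathbb{R}^n\to\mathbb{C}$ that are $C^\infty$ and satisfy $\sup_{x\in\mathbb{R}^n}|x^\alpha\partial^\beta f(x)|<\infty$ for all multi-indices $\alpha,\beta\in\mathbb{N}^n$. $f\cdot g$ denotes the pointwise product and $\overline{g}$ the pointwise complex conjugate. Convolution is $(f\ast g)(x)=\int_{\mathbb{R}^n} f(x-y)\,g(y)\,dy$, $x\in\mathbb{R}^n$. $(f\circ B)(x)=f(Bx)$. The Fourier transform is $\mathcal{F}f(\xi)=(2\pi)^{-n/2}\int_{\mathbb{R}^n} f(x)\,e^{-ix\cdot\xi}\,dx$, $\xi\in\mathbb{R}^n$.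
   Formalization: Convolution is taken with the factor (2π)^(-n/2), matching the stated Fourier transform; with the unnormalised convolution the claim fails, e.g. for Tf(ξ)=∫f(x)e^{-2πi x·ξ}dx. The dimension n is at least 1. *)

theory Defs
  imports "HOL-Analysis.Analysis"
begin

definition partial :: "'n::finite \<Rightarrow> (real^'n \<Rightarrow> complex) \<Rightarrow> real^'n \<Rightarrow> complex" where
  "partial i f x = vector_derivative (\<lambda>t. f (x + t *\<^sub>R axis i 1)) (at 0)"

text \<open>\<open>C_k k f\<close>: all partial derivatives of \<open>f\<close> of order at most \<open>k\<close> exist everywhere and
  are continuous.  Existence is required explicitly, because \<^const>\<open>vector_derivative\<close> is total.\<close>

fun C_k :: "nat \<Rightarrow> (real^'n::finite \<Rightarrow> complex) \<Rightarrow> bool" where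
  "C_k 0 f \<longleftrightarrow> continuous_on UNIV f"
| "C_k (Suc k) f \<longleftrightarrow> continuous_on UNIV f \<and>
     (\<forall>i x. (\<lambda>t. f (x + t *\<^sub>R axis i 1)) differentiable (at 0)) \<and>
     (\<forall>i. C_k k (partial i f))"

definition smooth :: "(real^'n::finite \<Rightarrow> complex) \<Rightarrow> bool" where
  "smooth f \<longleftrightarrow> (\<forall>k. C_k k f)"

text \<open>The index type \<open>'n\<close> carries no order, so a derivative \<open>\<partial>\<^sup>\<beta>\<close> is given by a list of
  coordinate directions containing each \<open>i\<close> exactly \<open>\<beta> i\<close> times: for smooth \<open>f\<close> the order of
  differentiation is immaterial, and the lists exhaust all multi-indices.\<close>

definition partials :: "'n::finite list \<Rightarrow> (real^'n \<Rightarrow> complex) \<Rightarrow> real^'n \<Rightarrow> complex" where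
  "partials is f = foldr partial is f"

definition monomial :: "('n::finite \<Rightarrow> nat) \<Rightarrow> real^'n \<Rightarrow> real" where
  "monomial \<alpha> x = (\<Prod>i\<in>UNIV. (x $ i) ^ \<alpha> i)"

definition schwartz :: "(real^'n::finite \<Rightarrow> complex) set" where
  "schwartz = {f. smooth f \<and>
     (\<forall>\<alpha> is. bdd_above (range (\<lambda>x. norm (of_real (monomial \<alpha> x) * partials is f x))))}"

text \<open>Fourier transform and convolution are both taken with respect to the normalised Lebesgue
  measure \<open>(2\<pi>)\<^bsup>-n/2\<^esup> dx\<close>.  The factor in the convolution cannot be dropped while the Fourier
  transform is unitary: only with it does \<open>fourier\<close> turn products into convolutions and
  convolutions into products with no extra constants.\<close>

definition fourier_const :: "'n::finite itself \<Rightarrow> real" where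
  "fourier_const _ = (2 * pi) powr (- real CARD('n) / 2)"

definition fourier :: "(real^'n::finite \<Rightarrow> complex) \<Rightarrow> real^'n \<Rightarrow> complex" where
  "fourier f \<xi> = of_real (fourier_const TYPE('n)) *
     (LINT x|lborel. f x * exp (- \<i> * of_real (x \<bullet> \<xi>)))"

definition convolution ::
  "(real^'n::finite \<Rightarrow> complex) \<Rightarrow> (real^'n \<Rightarrow> complex) \<Rightarrow> real^'n \<Rightarrow> complex" where
  "convolution f g x = of_real (fourier_const TYPE('n)) * (LINT y|lborel. f (x - y) * g y)"

definition star :: "(real^'n::finite \<Rightarrow> complex) \<Rightarrow> real^'n \<Rightarrow> complex" where
  "star f x = cnj (f (- x))"

end

theory Submission
  imports
    "HOL-Probability.Sinc_Integral"
    "HOL-Probability.Characteristic_Functions"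
    "HOL-Real_Asymp.Real_Asymp"
    Defs (* last, so that convolution is not the constant of HOL-Probability *)
begin

text \<open>
  Put \<open>U f = \<F>\<^sup>-\<^sup>1 (T f)\<close>, taken pointwise as an integral.  For each \<open>x\<close> the map \<open>f \<mapsto> U f x\<close> is a nonzero
  ring homomorphism from the pointwise algebra of Schwartz functions to the complex numbers that
  commutes with conjugation.  It induces a field endomorphism of the complex numbers that fixes the
  reals, hence is the identity or conjugation, and its kernel is the ideal of functions vanishing
  at some point \<open>\<phi> x\<close>.  So \<open>U f\<close> is \<open>f \<circ> \<phi>\<close> or its conjugate, with \<open>\<phi>\<close> continuous.

  Since \<open>T\<close> turns convolutions into products, the functions \<open>G \<circ> \<phi>\<close> with \<open>G\<close> Gaussian satisfy the
  same convolution identities as the \<open>G\<close> themselves.  Letting the width tend to \<open>0\<close> shows that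
  \<open>\<phi>\<close> is additive, hence linear, \<open>\<phi> x = B x\<close>.  Injectivity of \<open>T\<close> makes \<open>B\<close> invertible,
  and comparing integrals gives \<open>\<bar>det B\<bar> = 1\<close>.

  No mapping property of the Fourier transform on Schwartz space is needed: \<open>U G = G \<circ> \<phi>\<close> is
  nonnegative, and a nonnegative inverse transform of a bounded continuous integrable function is
  itself integrable.
\<close>

section \<open>Closure properties of the Schwartz space\<close>

text \<open>Condition (a) makes \<open>T\<close> additive and compatible with conjugation but says
  nothing about complex scalars, and the complex numbers have discontinuous field automorphisms.
  Compatibility with conjugation excludes them: it sends reals to reals, where squares force a
  unital ring homomorphism to be monotone.

  The other obstacle is a circle. Condition (c) becomes a statement about \<open>U\<close> only
  through \<open>T f = fourier (U f)\<close>, which presupposes that \<open>U f\<close> is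
  integrable; for general \<open>f\<close> that is known only once \<phi> is an invertible linear
  map. Gaussians break the circle: positivity makes their images under \<open>U\<close> integrable
  before anything is known about the growth of \<phi>, and they are closed under convolution up to
  constants, so (c) on Gaussians alone already determines \<phi>.

  The choice between identity and conjugation is made at each point separately. A continuous
  function with values 1 and -1 that records the choice shows that it is the same
  everywhere.\<close>

definition has_pd :: "'n::finite \<Rightarrow> (real^'n \<Rightarrow> complex) \<Rightarrow> (real^'n \<Rightarrow> complex) \<Rightarrow> bool" where
  "has_pd i f f' \<longleftrightarrow> (\<forall>x. ((\<lambda>t. f (x + t *\<^sub>R axis i 1)) has_vector_derivative f' x) (at 0))"

text \<open>Powers of \<open>1 + norm x\<close> take the place of monomials, so that products and
  linear substitutions become plain norm estimates. \<open>decayingI_monomial\<close> and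
  \<open>decaying_monomial\<close> translate between the two forms.\<close>

definition decaying :: "(real^'n::finite \<Rightarrow> complex) \<Rightarrow> bool" where
  "decaying f \<longleftrightarrow> (\<forall>N. \<exists>C. \<forall>x. norm (f x) * (1 + norm x) ^ N \<le> C)"

lemma has_pd_partial: "has_pd i f f' \<Longrightarrow> partial i f = f'"
  by (auto simp: has_pd_def partial_def fun_eq_iff intro!: vector_derivative_at)

lemma decayingE:
  assumes "decaying f"
  obtains C where "C > 0" "\<And>x. norm (f x) * (1 + norm x) ^ N \<le> C"
proof -
  from assms obtain C where C: "\<And>x. norm (f x) * (1 + norm x) ^ N \<le> C"
    unfolding decaying_def by blast
  have "norm (f x) * (1 + norm x) ^ N \<le> \<bar>C\<bar> + 1" for x
    using C[of x] by linarith
  then show ?thesis by (rule that[rotated]) auto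
qed

lemma decayingI_monomial:
  fixes f :: "real^'n::finite \<Rightarrow> complex"
  assumes "\<And>\<alpha>. bdd_above (range (\<lambda>x. norm (of_real (monomial \<alpha> x) * f x)))"
  shows "decaying f"
proof -
  \<comment> \<open>The l1 norm dominates the Euclidean norm and expands into coordinates: one more
    factor turns the monomial with exponent \<alpha> into itself plus those with one entry of
    \<alpha> raised. Hence \<alpha> stays arbitrary in the induction.\<close>
  have *: "\<exists>C. \<forall>x. norm (of_real (monomial \<alpha> x) * f x) * (1 + (\<Sum>i\<in>UNIV. \<bar>x $ i\<bar>)) ^ N \<le> C"
    for N and \<alpha> :: "'n \<Rightarrow> nat"
  proof (induction N arbitrary: \<alpha>)
    case 0
    then show ?case using assms[of \<alpha>] by (auto simp: bdd_above_def)
  next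
    case (Suc N)
    let ?a = "\<lambda>i. \<alpha>(i := Suc (\<alpha> i))"
    have mon: "monomial (?a i) x = x $ i * monomial \<alpha> x" for i and x :: "real^'n"
      unfolding monomial_def
      by (subst (1 2) prod.remove[of UNIV i]) (auto intro!: prod.cong)
    obtain C0 where C0: "\<And>x. norm (of_real (monomial \<alpha> x) * f x) * (1 + (\<Sum>i\<in>UNIV. \<bar>x $ i\<bar>)) ^ N \<le> C0"
      using Suc.IH by blast
    have "\<forall>i. \<exists>C. \<forall>x. norm (of_real (monomial (?a i) x) * f x) * (1 + (\<Sum>i\<in>UNIV. \<bar>x $ i\<bar>)) ^ N \<le> C"
      using Suc.IH by blast
    then obtain C where C: "\<And>i x. norm (of_real (monomial (?a i) x) * f x) * (1 + (\<Sum>i\<in>UNIV. \<bar>x $ i\<bar>)) ^ N \<le> C i"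
      by metis
    have "norm (of_real (monomial \<alpha> x) * f x) * (1 + (\<Sum>i\<in>UNIV. \<bar>x $ i\<bar>)) ^ Suc N \<le> C0 + (\<Sum>i\<in>UNIV. C i)" for x
    proof -
      let ?S = "(1 + (\<Sum>i\<in>UNIV. \<bar>x $ i\<bar>)) ^ N"
      have "norm (of_real (monomial \<alpha> x) * f x) * (1 + (\<Sum>i\<in>UNIV. \<bar>x $ i\<bar>)) ^ Suc N
          = norm (of_real (monomial \<alpha> x) * f x) * ?S
            + (\<Sum>i\<in>UNIV. norm (of_real (monomial (?a i) x) * f x) * ?S)"
        by (simp add: mon norm_mult sum_distrib_left sum_distrib_right algebra_simps)
      also have "\<dots> \<le> C0 + (\<Sum>i\<in>UNIV. C i)"
        by (intro add_mono sum_mono C C0)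
      finally show ?thesis .
    qed
    then show ?case by blast
  qed
  show ?thesis unfolding decaying_def
  proof
    fix N
    from *[of "\<lambda>_. 0" N] obtain C where C: "\<And>x. norm (f x) * (1 + (\<Sum>i\<in>UNIV. \<bar>x $ i\<bar>)) ^ N \<le> C"
      by (auto simp: monomial_def)
    have "norm (f x) * (1 + norm x) ^ N \<le> C" for x
    proof -
      have "norm (f x) * (1 + norm x) ^ N \<le> norm (f x) * (1 + (\<Sum>i\<in>UNIV. \<bar>x $ i\<bar>)) ^ N"
        by (intro mult_left_mono power_mono add_left_mono norm_le_l1_cart) auto
      with C[of x] show ?thesis by linarith
    qed
    then show "\<exists>C. \<forall>x. norm (f x) * (1 + norm x) ^ N \<le> C" by blast
  qed
qed

lemma decaying_monomial:
  fixes f :: "real^'n::finite \<Rightarrow> complex"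
  assumes "decaying f"
  shows "bdd_above (range (\<lambda>x. norm (of_real (monomial \<alpha> x) * f x)))"
proof -
  let ?N = "\<Sum>i\<in>UNIV. \<alpha> i"
  obtain C where C: "\<And>x. norm (f x) * (1 + norm x) ^ ?N \<le> C"
    using assms by (metis decayingE)
  have "norm (of_real (monomial \<alpha> x) * f x) \<le> C" for x
  proof -
    have "\<bar>monomial \<alpha> x\<bar> = (\<Prod>i\<in>UNIV. \<bar>x $ i\<bar> ^ \<alpha> i)"
      by (simp add: monomial_def abs_prod power_abs)
    also have "\<dots> \<le> (\<Prod>i\<in>UNIV. (1 + norm x) ^ \<alpha> i)"
      by (intro prod_mono conjI power_mono zero_le_power)
         (auto intro: order_trans[OF component_le_norm_cart])
    also have "\<dots> = (1 + norm x) ^ ?N"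
      by (simp add: power_sum)
    finally have "norm (of_real (monomial \<alpha> x) * f x) \<le> norm (f x) * (1 + norm x) ^ ?N"
      by (simp add: norm_mult mult.commute mult_left_mono)
    with C[of x] show ?thesis by linarith
  qed
  then show ?thesis by (auto simp: bdd_above_def)
qed

text \<open>The Schwartz space is the largest such class, so membership proofs reduce to exhibiting a class
  of rapidly decaying functions closed under partial derivatives.\<close>

lemma schwartz_coinduct:
  assumes cont: "\<And>f. f \<in> A \<Longrightarrow> continuous_on UNIV f"
    and pd: "\<And>f i. f \<in> A \<Longrightarrow> \<exists>f'\<in>A. has_pd i f f'"
    and dec: "\<And>f. f \<in> A \<Longrightarrow> decaying f"
  shows "A \<subseteq> schwartz"
proof
  fix f assume f: "f \<in> A"
  have p: "partial i g \<in> A" if "g \<in> A" for g i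
    using pd[OF that] has_pd_partial by metis
  have "C_k k g" if "g \<in> A" for k g
    using that
  proof (induction k arbitrary: g)
    case (Suc k)
    have "(\<lambda>t. g (x + t *\<^sub>R axis i 1)) differentiable (at 0)" for i x
      using pd[OF Suc.prems, of i] unfolding has_pd_def
      by (meson differentiableI_vector)
    then show ?case using Suc cont p by auto
  qed (use cont in auto)
  then have "smooth f" using f by (simp add: smooth_def)
  moreover have "partials is f \<in> A" for "is"
    by (induction "is") (use f p in \<open>auto simp: partials_def\<close>)
  then have "bdd_above (range (\<lambda>x. norm (of_real (monomial \<alpha> x) * partials is f x)))" for \<alpha> "is"
    by (rule decaying_monomial[OF dec])
  ultimately show "f \<in> schwartz"
    by (simp add: schwartz_def)
qed

lemma schwartz_cont: "f \<in> schwartz \<Longrightarrow> continuous_on UNIV f"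
  unfolding schwartz_def smooth_def by (metis (lifting) C_k.simps(1) mem_Collect_eq)

lemma schwartz_decaying: "f \<in> schwartz \<Longrightarrow> decaying f"
proof (rule decayingI_monomial)
  fix \<alpha> assume "f \<in> schwartz"
  then have "bdd_above (range (\<lambda>x. norm (of_real (monomial \<alpha> x) * partials [] f x)))"
    unfolding schwartz_def mem_Collect_eq by metis
  then show "bdd_above (range (\<lambda>x. norm (of_real (monomial \<alpha> x) * f x)))"
    by (simp add: partials_def)
qed

lemma schwartz_pd:
  assumes "f \<in> schwartz"
  shows "has_pd i f (partial i f)" "partial i f \<in> schwartz"
proof -
  have *: "C_k (Suc k) f" for k using assms unfolding schwartz_def smooth_def by blast
  show "has_pd i f (partial i f)"
    using *[of 0] unfolding has_pd_def partial_def by (simp flip: vector_derivative_works)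
  have "smooth (partial i f)" unfolding smooth_def using * by auto
  moreover have "bdd_above (range (\<lambda>x. norm (of_real (monomial \<alpha> x) * partials is (partial i f) x)))" for \<alpha> "is"
  proof -
    have "partials is (partial i f) = partials (is @ [i]) f" by (simp add: partials_def)
    then show ?thesis using assms unfolding schwartz_def by auto
  qed
  ultimately show "partial i f \<in> schwartz" by (simp add: schwartz_def)
qed

lemma decaying_add:
  assumes "decaying f" "decaying g" shows "decaying (\<lambda>x. f x + g x)"
  unfolding decaying_def
proof
  fix N
  obtain C D where C: "\<And>x. norm (f x) * (1 + norm x) ^ N \<le> C" and D: "\<And>x. norm (g x) * (1 + norm x) ^ N \<le> D"
    using assms by (meson decayingE)
  have "norm (f x + g x) * (1 + norm x) ^ N \<le> C + D" for x
  proof -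
    have "norm (f x + g x) * (1 + norm x) ^ N \<le> (norm (f x) + norm (g x)) * (1 + norm x) ^ N"
      by (intro mult_right_mono norm_triangle_ineq) auto
    then show ?thesis using C[of x] D[of x] by (simp add: algebra_simps)
  qed
  then show "\<exists>C. \<forall>x. norm (f x + g x) * (1 + norm x) ^ N \<le> C" by blast
qed

lemma decaying_mult:
  assumes f: "decaying f" and g: "\<And>x. norm (g x) \<le> C * (1 + norm x) ^ k"
  shows "decaying (\<lambda>x. g x * f x)"
  unfolding decaying_def
proof
  fix N
  obtain D where D: "\<And>x. norm (f x) * (1 + norm x) ^ (k + N) \<le> D" "D > 0"
    using f by (metis decayingE)
  have "norm (g x * f x) * (1 + norm x) ^ N \<le> \<bar>C\<bar> * D" for x
  proof -
    have "norm (g x) \<le> \<bar>C\<bar> * (1 + norm x) ^ k"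
      by (rule order_trans[OF g]) (intro mult_right_mono, auto)
    then have "norm (g x * f x) * (1 + norm x) ^ N \<le> (\<bar>C\<bar> * (1 + norm x) ^ k) * norm (f x) * (1 + norm x) ^ N"
      unfolding norm_mult by (intro mult_right_mono) auto
    also have "\<dots> = \<bar>C\<bar> * (norm (f x) * (1 + norm x) ^ (k + N))"
      by (simp add: power_add)
    also have "\<dots> \<le> \<bar>C\<bar> * D" by (intro mult_left_mono D) auto
    finally show ?thesis .
  qed
  then show "\<exists>C. \<forall>x. norm (g x * f x) * (1 + norm x) ^ N \<le> C" by blast
qed

lemma schwartz_bounded:
  assumes "f \<in> schwartz"
  obtains C where "C > 0" "\<And>x. norm (f x) \<le> C"
  using decayingE[OF schwartz_decaying[OF assms], of 0] by (metis mult.right_neutral power_0)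

lemma has_pd_add: "has_pd i f f' \<Longrightarrow> has_pd i g g' \<Longrightarrow> has_pd i (\<lambda>x. f x + g x) (\<lambda>x. f' x + g' x)"
  unfolding has_pd_def by (auto intro: has_vector_derivative_add)

lemma has_pd_mult:
  "has_pd i f f' \<Longrightarrow> has_pd i g g' \<Longrightarrow> has_pd i (\<lambda>x. f x * g x) (\<lambda>x. f x * g' x + f' x * g x)"
  unfolding has_pd_def
proof (intro allI)
  fix x
  assume "\<forall>x. ((\<lambda>t. f (x + t *\<^sub>R axis i 1)) has_vector_derivative f' x) (at 0)"
    and "\<forall>x. ((\<lambda>t. g (x + t *\<^sub>R axis i 1)) has_vector_derivative g' x) (at 0)"
  from has_vector_derivative_mult[OF this[THEN spec, of x]]
  show "((\<lambda>t. f (x + t *\<^sub>R axis i 1) * g (x + t *\<^sub>R axis i 1)) has_vector_derivative f x * g' x + f' x * g x) (at 0)"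
    by simp
qed

lemma has_pd_const: "has_pd i (\<lambda>x. c) (\<lambda>x. 0)"
  unfolding has_pd_def by auto

lemma has_pd_cnj: "has_pd i f f' \<Longrightarrow> has_pd i (\<lambda>x. cnj (f x)) (\<lambda>x. cnj (f' x))"
  unfolding has_pd_def using bounded_linear.has_vector_derivative[OF bounded_linear_cnj] by blast

lemma has_pd_coord: "has_pd i (\<lambda>x. of_real (x $ j)) (\<lambda>x. if i = j then 1 else 0)"
  unfolding has_pd_def
proof (intro allI)
  fix x :: "real^'a"
  have "((\<lambda>t. x $ j + t * (if i = j then 1 else 0)) has_vector_derivative (if i = j then 1 else 0)) (at 0)"
    by (auto intro!: derivative_eq_intros simp: has_vector_derivative_def)
  from bounded_linear.has_vector_derivative[OF bounded_linear_of_real this]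
  show "((\<lambda>t. complex_of_real ((x + t *\<^sub>R axis i 1) $ j)) has_vector_derivative (if i = j then 1 else 0)) (at 0)"
    by (cases "i = j") (simp_all add: axis_def)
qed

lemma schwartz_add:
  assumes "f \<in> schwartz" "g \<in> schwartz" shows "(\<lambda>x. f x + g x) \<in> schwartz"
proof -
  let ?A = "{\<lambda>x. f x + g x | f g. f \<in> schwartz \<and> g \<in> schwartz}"
  have "?A \<subseteq> schwartz"
    by (rule schwartz_coinduct)
       (fast intro: continuous_on_add schwartz_cont decaying_add schwartz_decaying schwartz_pd has_pd_add)+
  then show ?thesis using assms by blast
qed

lemma schwartz_sum:
  assumes "finite I" "I \<noteq> {}" "\<And>i. i \<in> I \<Longrightarrow> f i \<in> schwartz"
  shows "(\<lambda>x. \<Sum>i\<in>I. f i x) \<in> schwartz"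
  using assms by (induction I rule: finite_ne_induct) (auto intro: schwartz_add)

lemma schwartz_cnj:
  assumes "f \<in> schwartz" shows "(\<lambda>x. cnj (f x)) \<in> schwartz"
proof -
  let ?A = "{\<lambda>x. cnj (f x) | f :: real^'a \<Rightarrow> complex. f \<in> schwartz}"
  have d: "decaying (\<lambda>x. cnj (f x))" if "f \<in> schwartz" for f :: "real^'a \<Rightarrow> complex"
    using schwartz_decaying[OF that] by (simp add: decaying_def)
  have "?A \<subseteq> schwartz"
  proof (rule schwartz_coinduct; safe)
    fix f :: "real^'a \<Rightarrow> complex" and i :: 'a assume "f \<in> schwartz"
    then show "\<exists>f'\<in>?A. has_pd i (\<lambda>x. cnj (f x)) f'"
      using has_pd_cnj schwartz_pd by blast
  qed (auto intro: continuous_on_cnj schwartz_cont d)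
  then show ?thesis using assms by blast
qed

text \<open>By the Leibniz rule the derivative of a product is a sum of two products, so the
  products alone are not closed under differentiation. The class \<open>A\<close> of their finite
  sums is, and it is obtained as a least fixed point.\<close>

lemma schwartz_mult:
  fixes f g :: "real^'n::finite \<Rightarrow> complex"
  assumes "f \<in> schwartz" "g \<in> schwartz" shows "(\<lambda>x. f x * g x) \<in> schwartz"
proof -
  define M :: "((real^'n \<Rightarrow> complex) set) \<Rightarrow> (real^'n \<Rightarrow> complex) set" where
    "M = (\<lambda>A. {\<lambda>x. f x * g x | f g. f \<in> schwartz \<and> g \<in> schwartz} \<union> {\<lambda>x. f x + g x | f g. f \<in> A \<and> g \<in> A})"
  have mono: "mono M" unfolding M_def mono_def by blast
  define A where "A = lfp M"
  have A1: "(\<lambda>x. f x * g x) \<in> A" if "f \<in> schwartz" "g \<in> schwartz" for f g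
    unfolding A_def by (subst lfp_unfold[OF mono]) (use that in \<open>auto simp: M_def\<close>)
  have A2: "(\<lambda>x. f x + g x) \<in> A" if "f \<in> A" "g \<in> A" for f g
    using that unfolding A_def by (subst lfp_unfold[OF mono]) (auto simp: M_def)
  have d: "decaying (\<lambda>x. f x * g x)" if fg: "f \<in> schwartz" "g \<in> schwartz" for f g :: "real^'n \<Rightarrow> complex"
  proof -
    obtain C where "\<And>x. norm (f x) \<le> C" using schwartz_bounded[OF fg(1)] by metis
    then show ?thesis using schwartz_decaying[OF fg(2)] by (intro decaying_mult[of _ _ C 0]) auto
  qed
  have "A \<subseteq> {f \<in> A. continuous_on UNIV f \<and> decaying f \<and> (\<forall>i. \<exists>f'\<in>A. has_pd i f f')}"
    unfolding A_def
  proof (rule lfp_induct[OF mono], fold A_def, rule subsetI)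
    fix h assume "h \<in> M (A \<inter> {f \<in> A. continuous_on UNIV f \<and> decaying f \<and> (\<forall>i. \<exists>f'\<in>A. has_pd i f f')})"
    then consider f g where "h = (\<lambda>x. f x * g x)" "f \<in> schwartz" "g \<in> schwartz"
      | f g where "h = (\<lambda>x. f x + g x)" "f \<in> A" "continuous_on UNIV f" "decaying f" "\<forall>i. \<exists>f'\<in>A. has_pd i f f'"
         "g \<in> A" "continuous_on UNIV g" "decaying g" "\<forall>i. \<exists>f'\<in>A. has_pd i g f'"
      unfolding M_def by blast
    then show "h \<in> {f \<in> A. continuous_on UNIV f \<and> decaying f \<and> (\<forall>i. \<exists>f'\<in>A. has_pd i f f')}"
    proof cases
      case 1
      have "\<exists>f'\<in>A. has_pd i h f'" for i
      proof
        show "has_pd i h (\<lambda>x. f x * partial i g x + partial i f x * g x)"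
          unfolding 1(1) by (intro has_pd_mult schwartz_pd 1)
        show "(\<lambda>x. f x * partial i g x + partial i f x * g x) \<in> A"
          by (intro A2 A1 schwartz_pd 1)
      qed
      moreover have "continuous_on UNIV h" unfolding 1(1) by (intro continuous_on_mult schwartz_cont 1)
      ultimately show ?thesis using 1 A1 d by auto
    next
      case 2
      have "\<exists>f'\<in>A. has_pd i h f'" for i
      proof -
        obtain f' g' where "f' \<in> A" "has_pd i f f'" "g' \<in> A" "has_pd i g g'" using 2(5,9) by blast
        then show ?thesis unfolding 2(1) by (intro bexI[of _ "\<lambda>x. f' x + g' x"] has_pd_add A2)
      qed
      moreover have "continuous_on UNIV h" "decaying h" unfolding 2(1) by (intro continuous_on_add decaying_add 2)+
      ultimately show ?thesis using 2 A2 by auto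
    qed
  qed
  then have "A \<subseteq> schwartz" by (intro schwartz_coinduct) blast+
  then show ?thesis using A1 assms by blast
qed

lemma schwartz_scale:
  assumes "f \<in> schwartz" shows "(\<lambda>x. c * f x) \<in> schwartz"
proof -
  let ?A = "{\<lambda>x. c * f x | f :: real^'a \<Rightarrow> complex. f \<in> schwartz}"
  have d: "decaying (\<lambda>x. c * f x)" if "f \<in> schwartz" for f :: "real^'a \<Rightarrow> complex"
    using schwartz_decaying[OF that] by (rule decaying_mult[of _ _ "norm c" 0]) auto
  have p: "has_pd i (\<lambda>x. c * f x) (\<lambda>x. c * partial i f x)" if "f \<in> schwartz" for i and f :: "real^'a \<Rightarrow> complex"
    using has_pd_mult[OF has_pd_const schwartz_pd(1)[OF that], of i c] by simp
  have "?A \<subseteq> schwartz"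
  proof (rule schwartz_coinduct; safe)
    fix f :: "real^'a \<Rightarrow> complex" and i :: 'a assume "f \<in> schwartz"
    then show "\<exists>f'\<in>?A. has_pd i (\<lambda>x. c * f x) f'"
      using p schwartz_pd(2) by blast
  qed (auto intro: continuous_on_mult_left schwartz_cont d)
  then show ?thesis using assms by blast
qed

lemma decaying_coord: "decaying f \<Longrightarrow> decaying (\<lambda>x. of_real (x $ j) * f x)"
  by (rule decaying_mult[of _ _ 1 1]) (auto intro: order_trans[OF component_le_norm_cart])

text \<open>Differentiating in direction \<open>j\<close> leaves an extra copy of \<open>f\<close>;
  the summand \<open>g\<close> in the class \<open>?A\<close> absorbs it.\<close>

lemma schwartz_coord:
  assumes "f \<in> schwartz" shows "(\<lambda>x. of_real (x $ j) * f x) \<in> schwartz"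
proof -
  let ?A = "{\<lambda>x. of_real (x $ j) * f x + g x | f g. f \<in> schwartz \<and> g \<in> schwartz}"
  have A: "(\<lambda>x. of_real (x $ j) * f x + g x) \<in> ?A" if "f \<in> schwartz" "g \<in> schwartz" for f g
    using that by blast
  have "?A \<subseteq> schwartz"
  proof (rule schwartz_coinduct; safe)
    fix f g :: "real^'a \<Rightarrow> complex" and i assume fg: "f \<in> schwartz" "g \<in> schwartz"
    let ?d = "if i = j then 1 else 0"
    have "(\<lambda>x. ?d * f x + partial i g x) \<in> schwartz"
      by (intro schwartz_add schwartz_scale schwartz_pd fg)
    then have "(\<lambda>x. of_real (x $ j) * partial i f x + (?d * f x + partial i g x)) \<in> ?A"
      by (rule A[OF schwartz_pd(2)[OF fg(1)]])
    moreover have "has_pd i (\<lambda>x. of_real (x $ j) * f x + g x)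
        (\<lambda>x. of_real (x $ j) * partial i f x + (?d * f x + partial i g x))"
      using has_pd_add[OF has_pd_mult[OF has_pd_coord[of i j] schwartz_pd(1)[OF fg(1), of i]] schwartz_pd(1)[OF fg(2), of i]]
      by (simp add: add.assoc cong: if_cong)
    ultimately show "\<exists>f'\<in>?A. has_pd i (\<lambda>x. of_real (x $ j) * f x + g x) f'" by blast
  qed (intro continuous_intros schwartz_cont decaying_add decaying_coord schwartz_decaying; assumption)+
  moreover have "(\<lambda>x. of_real (x $ j) * f x + 0 * f x) \<in> ?A"
    by (rule A[OF assms schwartz_scale[OF assms]])
  ultimately show ?thesis by auto
qed

lemma schwartz_uminus: "f \<in> schwartz \<Longrightarrow> (\<lambda>x. - f x) \<in> schwartz"
  using schwartz_scale[of f "-1"] by simp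

lemma schwartz_diff: "f \<in> schwartz \<Longrightarrow> g \<in> schwartz \<Longrightarrow> (\<lambda>x. f x - g x) \<in> schwartz"
  using schwartz_add[OF _ schwartz_uminus] by fastforce

lemma schwartz_shift_coord:
  assumes "f \<in> schwartz" shows "(\<lambda>x. of_real (x $ j - a) * f x) \<in> schwartz"
  using schwartz_diff[OF schwartz_coord schwartz_scale, OF assms assms, of j a]
  by (simp add: algebra_simps)

text \<open>Each application of the quotient rule raises the exponent of \<open>w\<close>, so the
  invariant class consists of all \<open>f x / w x ^ k\<close>. Since \<open>w\<close> may grow, it
  enters as a multiplier of the Schwartz space and not as an element; the bound \<delta> keeps its
  inverse powers bounded. The division serves the kernel argument in
  \<open>schwartz_character\<close>.\<close>

lemma schwartz_divide:
  fixes w :: "real^'n::finite \<Rightarrow> complex"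
  assumes f: "f \<in> schwartz" and w: "continuous_on UNIV w" "\<And>i. has_pd i w (w' i)"
    and ws: "\<And>f. f \<in> schwartz \<Longrightarrow> (\<lambda>x. w x * f x) \<in> schwartz"
    and ws': "\<And>f i. f \<in> schwartz \<Longrightarrow> (\<lambda>x. w' i x * f x) \<in> schwartz"
    and \<delta>: "\<delta> > 0" "\<And>x. norm (w x) \<ge> \<delta>"
  shows "(\<lambda>x. f x / w x) \<in> schwartz"
proof -
  have w0: "w x \<noteq> 0" for x using \<delta>(1) \<delta>(2)[of x] by auto
  let ?A = "{\<lambda>x. f x / w x ^ k | f k. f \<in> schwartz}"
  have pd: "has_pd i (\<lambda>x. f x / w x ^ k) (\<lambda>x. (w x * partial i f x - of_nat k * (w' i x * f x)) / w x ^ Suc k)"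
    if "f \<in> schwartz" for i and f :: "real^'n \<Rightarrow> complex" and k
    unfolding has_pd_def
  proof
    fix x
    let ?W = "\<lambda>t. w (x + t *\<^sub>R axis i 1)" and ?F = "\<lambda>t. f (x + t *\<^sub>R axis i 1)"
    have W: "(?W has_vector_derivative w' i x) (at 0)" using w(2) by (auto simp: has_pd_def)
    have F: "(?F has_vector_derivative partial i f x) (at 0)" using schwartz_pd(1)[OF that] by (auto simp: has_pd_def)
    have "((\<lambda>z. inverse (z ^ k)) has_field_derivative - of_nat k * inverse (w x ^ Suc k)) (at (?W 0))"
      using w0[of x] by (auto intro!: derivative_eq_intros simp: field_simps power_Suc)
         (cases k; simp add: field_simps)
    from field_vector_diff_chain_at[OF W this]
    have "((\<lambda>t. inverse (?W t ^ k)) has_vector_derivative w' i x * (- of_nat k * inverse (w x ^ Suc k))) (at 0)"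
      by (simp add: o_def)
    note D = has_vector_derivative_mult[OF F this]
    have "f x * (w' i x * (- of_nat k * inverse (w x ^ Suc k))) + partial i f x * inverse (w x ^ k) =
        (w x * partial i f x - of_nat k * (w' i x * f x)) / w x ^ Suc k"
      using w0[of x] by (simp add: field_simps)
    with D show "((\<lambda>t. ?F t / ?W t ^ k) has_vector_derivative
        (w x * partial i f x - of_nat k * (w' i x * f x)) / w x ^ Suc k) (at 0)"
      by (simp add: divide_inverse)
  qed
  have A: "(\<lambda>x. f x / w x ^ k) \<in> ?A" if "f \<in> schwartz" for f k
    using that by blast
  have "?A \<subseteq> schwartz"
  proof (rule schwartz_coinduct; safe)
    fix f :: "real^'n \<Rightarrow> complex" and i :: 'n and k assume f: "f \<in> schwartz"
    have "(\<lambda>x. w x * partial i f x - of_nat k * (w' i x * f x)) \<in> schwartz"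
      by (intro schwartz_diff ws ws' schwartz_scale schwartz_pd f)
    from A[OF this, of "Suc k"] pd[OF f, of i k] show "\<exists>f'\<in>?A. has_pd i (\<lambda>x. f x / w x ^ k) f'"
      by (intro bexI[of _ "\<lambda>x. (w x * partial i f x - of_nat k * (w' i x * f x)) / w x ^ Suc k"])
  next
    fix f :: "real^'n \<Rightarrow> complex" and k assume f: "f \<in> schwartz"
    show "continuous_on UNIV (\<lambda>x. f x / w x ^ k)"
      using w0 by (intro continuous_intros schwartz_cont f w) auto
    have "decaying (\<lambda>x. inverse (w x ^ k) * f x)"
    proof (rule decaying_mult[OF schwartz_decaying[OF f], of _ "inverse (\<delta> ^ k)" 0])
      fix x
      show "norm (inverse (w x ^ k)) \<le> inverse (\<delta> ^ k) * (1 + norm x) ^ 0"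
        using \<delta>(1) \<delta>(2)[of x] by (auto simp: norm_inverse norm_power intro!: le_imp_inverse_le power_mono)
    qed
    then show "decaying (\<lambda>x. f x / w x ^ k)" by (simp add: field_simps)
  qed
  moreover have "(\<lambda>x. f x / w x ^ 1) \<in> ?A" by (rule A[OF f])
  ultimately show ?thesis by auto
qed

section \<open>Gaussians as Schwartz functions\<close>

definition gaussian :: "real^'n::finite \<Rightarrow> real \<Rightarrow> real^'n \<Rightarrow> complex" where
  "gaussian p s x = of_real (exp (- (norm (x - p))\<^sup>2 / (2 * s)))"

lemma norm_shift_axis:
  "(norm (x + t *\<^sub>R axis i 1 - p))\<^sup>2 = (norm (x - p))\<^sup>2 + 2 * t * (x $ i - p $ i) + t\<^sup>2"
  for x :: "real^'n::finite"
proof -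
  have "(norm ((x - p) + t *\<^sub>R axis i 1))\<^sup>2 = (norm (x - p))\<^sup>2 + 2 * t * (x $ i - p $ i) + t\<^sup>2"
    unfolding power2_norm_eq_inner inner_add_left inner_add_right
    by (simp add: inner_axis inner_axis' power2_eq_square)
  then show ?thesis by (simp add: algebra_simps)
qed

lemma gaussian_has_pd:
  assumes "s > 0"
  shows "has_pd i (gaussian p s) (\<lambda>x. of_real (- (x $ i - p $ i) / s) * gaussian p s x)"
  unfolding has_pd_def
proof
  fix x :: "real^'a"
  have "((\<lambda>t. exp (- ((norm (x - p))\<^sup>2 + 2 * t * (x $ i - p $ i) + t\<^sup>2) / (2 * s))) has_real_derivative
      - (x $ i - p $ i) / s * exp (- (norm (x - p))\<^sup>2 / (2 * s))) (at 0)"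
    using assms by (auto intro!: derivative_eq_intros simp: field_simps)
  from this[unfolded has_real_derivative_iff_has_vector_derivative]
  show "((\<lambda>t. gaussian p s (x + t *\<^sub>R axis i 1)) has_vector_derivative
        of_real (- (x $ i - p $ i) / s) * gaussian p s x) (at 0)"
    unfolding gaussian_def norm_shift_axis of_real_mult[symmetric]
    by (rule bounded_linear.has_vector_derivative[OF bounded_linear_of_real])
qed

lemma gaussian_decaying:
  assumes "s > 0" shows "decaying (gaussian p s)"
  unfolding decaying_def
proof
  fix N
  \<comment> \<open>With \<open>r = norm (x - p)\<close>, the factor \<open>1 + norm x\<close> is at
    most \<open>(1 + norm p) * exp r\<close>, and \<open>N * r - r^2 / (2 * s)\<close> is largest at
    \<open>r = N * s\<close>, where it equals \<open>N^2 * s / 2\<close>.\<close>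
  have "norm (gaussian p s x) * (1 + norm x) ^ N \<le> (1 + norm p) ^ N * exp (real N ^ 2 * s / 2)" for x
  proof -
    let ?r = "norm (x - p)"
    have "norm x \<le> norm p + ?r" by norm
    also have "\<dots> \<le> norm p + ?r + norm p * ?r" by simp
    finally have "1 + norm x \<le> (1 + norm p) * exp ?r"
      using mult_left_mono[OF exp_ge_add_one_self[of ?r], of "1 + norm p"] by (simp add: algebra_simps)
    then have "(1 + norm x) ^ N \<le> ((1 + norm p) * exp ?r) ^ N" by (intro power_mono) auto
    also have "\<dots> = (1 + norm p) ^ N * exp (real N * ?r)"
      by (simp add: power_mult_distrib exp_of_nat_mult)
    finally have "norm (gaussian p s x) * (1 + norm x) ^ N
        \<le> exp (- ?r\<^sup>2 / (2 * s)) * ((1 + norm p) ^ N * exp (real N * ?r))"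
      unfolding gaussian_def by (simp add: mult_left_mono)
    also have "\<dots> = (1 + norm p) ^ N * exp (- ?r\<^sup>2 / (2 * s) + real N * ?r)"
      by (simp only: exp_add mult_ac)
    also have "\<dots> \<le> (1 + norm p) ^ N * exp (real N ^ 2 * s / 2)"
    proof -
      have "0 \<le> (?r - real N * s)\<^sup>2 / (2 * s)" using assms by auto
      also have "\<dots> = real N ^ 2 * s / 2 - (- ?r\<^sup>2 / (2 * s) + real N * ?r)"
        using assms by (simp add: field_simps power2_eq_square)
      finally show ?thesis by (intro mult_left_mono) auto
    qed
    finally show ?thesis .
  qed
  then show "\<exists>C. \<forall>x. norm (gaussian p s x) * (1 + norm x) ^ N \<le> C" by blast
qed

lemma gaussian_cont: "continuous_on S (gaussian p s)"
  unfolding gaussian_def[abs_def] divide_inverse by (intro continuous_intros)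

text \<open>The polynomial multiples of one fixed Gaussian. Differentiating the Gaussian produces a
  polynomial factor of degree one, so this is the class closed under derivatives that
  \<open>schwartz_coinduct\<close> asks for.\<close>

inductive_set gauss_poly :: "real^'n::finite \<Rightarrow> real \<Rightarrow> (real^'n \<Rightarrow> complex) set" for p s where
  "gaussian p s \<in> gauss_poly p s"
| "f \<in> gauss_poly p s \<Longrightarrow> (\<lambda>x. c * f x) \<in> gauss_poly p s"
| "f \<in> gauss_poly p s \<Longrightarrow> (\<lambda>x. of_real (x $ i) * f x) \<in> gauss_poly p s"
| "f \<in> gauss_poly p s \<Longrightarrow> g \<in> gauss_poly p s \<Longrightarrow> (\<lambda>x. f x + g x) \<in> gauss_poly p s"

lemma gaussian_schwartz:
  assumes s: "s > 0" shows "gaussian p s \<in> schwartz"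
proof -
  have "continuous_on UNIV f \<and> decaying f \<and> (\<forall>i. \<exists>f'\<in>gauss_poly p s. has_pd i f f')"
    if "f \<in> gauss_poly p s" for f
    using that
  proof induction
    case 1
    have "\<exists>f'\<in>gauss_poly p s. has_pd i (gaussian p s) f'" for i
    proof
      show "has_pd i (gaussian p s) (\<lambda>x. of_real (- 1 / s) * (of_real (x $ i) * gaussian p s x)
          + of_real (p $ i / s) * gaussian p s x)"
        using gaussian_has_pd[OF s, of i p] s by (simp add: field_simps)
      show "(\<lambda>x. of_real (- 1 / s) * (of_real (x $ i) * gaussian p s x)
          + of_real (p $ i / s) * gaussian p s x) \<in> gauss_poly p s"
        by (intro gauss_poly.intros)
    qed
    then show ?case using gaussian_cont gaussian_decaying[OF s] by blast
  next
    case (2 f c)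
    have "\<exists>f'\<in>gauss_poly p s. has_pd i (\<lambda>x. c * f x) f'" for i
    proof -
      obtain f' where f': "f'\<in>gauss_poly p s" "has_pd i f f'" using 2 by blast
      have "has_pd i (\<lambda>x. c * f x) (\<lambda>x. c * f' x)"
        using has_pd_mult[OF has_pd_const f'(2), of c] by simp
      with f'(1) show ?thesis by (auto intro: gauss_poly.intros)
    qed
    then show ?case using 2 by (auto intro!: continuous_intros decaying_mult[of _ _ "norm c" 0])
  next
    case (3 f j)
    have "\<exists>f'\<in>gauss_poly p s. has_pd i (\<lambda>x. of_real (x $ j) * f x) f'" for i
    proof -
      obtain f' where f': "f'\<in>gauss_poly p s" "has_pd i f f'" using 3 by blast
      have "(\<lambda>x. of_real (x $ j) * f' x + (if i = j then 1 else 0) * f x) \<in> gauss_poly p s"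
        by (intro gauss_poly.intros f' 3)
      then show ?thesis using has_pd_mult[OF has_pd_coord f'(2)] by blast
    qed
    then show ?case using 3 by (auto intro!: continuous_intros decaying_coord)
  next
    case (4 f g)
    have "\<exists>f'\<in>gauss_poly p s. has_pd i (\<lambda>x. f x + g x) f'" for i
    proof -
      obtain f' g' where "f' \<in> gauss_poly p s" "has_pd i f f'" "g' \<in> gauss_poly p s" "has_pd i g g'"
        using 4 by blast
      then show ?thesis
        by (intro bexI[of _ "\<lambda>x. f' x + g' x"] has_pd_add gauss_poly.intros)
    qed
    then show ?case using 4 by (auto intro!: continuous_intros decaying_add)
  qed
  then have "gauss_poly p s \<subseteq> schwartz" by (intro schwartz_coinduct) auto
  then show ?thesis using gauss_poly.intros(1) by blast
qed

lemma schwartz_zero: "(\<lambda>x. 0) \<in> schwartz"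
  using schwartz_scale[OF gaussian_schwartz[of 1 0], of 0] by simp

section \<open>Characters of the pointwise algebra\<close>

text \<open>Cauchy's functional equation, applied at the end to \<phi>: additivity handles rational
  scalars, density and continuity the rest.\<close>

lemma additive_continuous_scaleR:
  fixes f :: "'a::real_normed_vector \<Rightarrow> 'b::real_normed_vector"
  assumes add: "\<And>x y. f (x + y) = f x + f y" and cont: "continuous_on UNIV f"
  shows "f (r *\<^sub>R x) = r *\<^sub>R f x"
proof -
  have "f 0 = 0" using add[of 0 0] by simp
  have nat: "f (real n *\<^sub>R y) = real n *\<^sub>R f y" for n y
    by (induction n) (simp_all add: \<open>f 0 = 0\<close> add scaleR_left_distrib)
  have neg: "f (- y) = - f y" for y
    using add[of y "- y"] \<open>f 0 = 0\<close> by (simp add: add_eq_0_iff)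
  have int: "f (of_int k *\<^sub>R y) = of_int k *\<^sub>R f y" for k y
    using nat neg by (cases k rule: int_cases) (auto simp del: of_nat_Suc)
  have rat: "f (q *\<^sub>R x) = q *\<^sub>R f x" if q: "q \<in> \<rat>" for q
  proof -
    obtain a b :: int where ab: "b > 0" "q = of_int a / of_int b"
      using Rats_cases'[OF q] by blast
    have "of_int b *\<^sub>R f (q *\<^sub>R x) = f (of_int b *\<^sub>R (q *\<^sub>R x))" by (rule int[symmetric])
    also have "\<dots> = of_int a *\<^sub>R f x" using ab by (simp add: int)
    finally have "of_int b *\<^sub>R f (q *\<^sub>R x) = of_int b *\<^sub>R (q *\<^sub>R f x)" using ab by simp
    then show ?thesis using ab(1) by (simp only: scaleR_cancel_left) simp
  qed
  have "continuous_on UNIV (\<lambda>r. f (r *\<^sub>R x) - r *\<^sub>R f x)"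
    by (intro continuous_intros continuous_on_compose2[OF cont]) auto
  then have "f (r *\<^sub>R x) - r *\<^sub>R f x = 0"
    unfolding Rats_closure_real[symmetric]
    by (rule continuous_constant_on_closure) (simp_all add: rat Rats_closure_real)
  then show ?thesis by simp
qed

text \<open>Continuity is replaced by order: a nonnegative real is a square, so its image is a
  square and \<tau> is monotone. A monotone map that fixes the rationals is the identity.\<close>

lemma real_ring_hom_id:
  fixes \<tau> :: "real \<Rightarrow> real"
  assumes add: "\<And>x y. \<tau> (x + y) = \<tau> x + \<tau> y" and mult: "\<And>x y. \<tau> (x * y) = \<tau> x * \<tau> y" and one: "\<tau> 1 = 1"
  shows "\<tau> r = r"
proof -
  have zero: "\<tau> 0 = 0" using add[of 0 0] by simp
  have neg: "\<tau> (- y) = - \<tau> y" for y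
    using add[of y "- y"] zero by (simp add: add_eq_0_iff)
  have mono: "\<tau> x \<le> \<tau> y" if "x \<le> y" for x y
  proof -
    have "\<tau> (y - x) = (\<tau> (sqrt (y - x)))\<^sup>2"
      using that mult[of "sqrt (y - x)" "sqrt (y - x)"] by (simp add: power2_eq_square)
    then have "0 \<le> \<tau> (y + - x)" by simp
    then show ?thesis by (simp only: add neg)
  qed
  have nat: "\<tau> (real n) = real n" for n
    by (induction n) (simp_all add: zero add one)
  have int: "\<tau> (of_int k) = of_int k" for k
    using nat neg by (cases k rule: int_cases) (auto simp del: of_nat_Suc)
  have rat: "\<tau> q = q" if q: "q \<in> \<rat>" for q
  proof -
    obtain a b :: int where ab: "b > 0" "q = of_int a / of_int b"
      using Rats_cases'[OF q] by blast
    have "of_int b * \<tau> q = \<tau> (of_int b * q)" by (simp only: mult) (simp only: int)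
    also have "\<dots> = of_int a" using ab by (simp add: int)
    finally have "\<tau> q = of_int a / of_int b" using ab(1) by (simp add: field_simps)
    with ab(2) show ?thesis by simp
  qed
  show ?thesis
  proof (rule ccontr)
    assume "\<tau> r \<noteq> r"
    then consider "\<tau> r < r" | "r < \<tau> r" by linarith
    then show False
    proof cases
      case 1
      then obtain q where "q \<in> \<rat>" "\<tau> r < q" "q < r" using Rats_dense_in_real by blast
      then show False using mono[of q r] rat by fastforce
    next
      case 2
      then obtain q where "q \<in> \<rat>" "r < q" "q < \<tau> r" using Rats_dense_in_real by blast
      then show False using mono[of r q] rat by fastforce
    qed
  qed
qed

text \<open>Commuting with \<open>cnj\<close> keeps the real line inside itself, where
  \<open>real_ring_hom_id\<close> applies. What remains free is the image of the imaginary unit, a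
  square root of -1.\<close>

lemma complex_ring_hom_cases:
  fixes \<sigma> :: "complex \<Rightarrow> complex"
  assumes add: "\<And>x y. \<sigma> (x + y) = \<sigma> x + \<sigma> y" and mult: "\<And>x y. \<sigma> (x * y) = \<sigma> x * \<sigma> y" and one: "\<sigma> 1 = 1"
    and cnj: "\<And>x. \<sigma> (cnj x) = cnj (\<sigma> x)"
  shows "(\<forall>x. \<sigma> x = x) \<or> (\<forall>x. \<sigma> x = cnj x)"
proof -
  have re: "\<sigma> (of_real r) = of_real (Re (\<sigma> (of_real r)))" for r
    using cnj[of "of_real r"] by (simp add: complex_eq_iff)
  have "Re (\<sigma> (of_real r)) = r" for r
  proof (rule real_ring_hom_id)
    fix x y
    show "Re (\<sigma> (of_real (x * y))) = Re (\<sigma> (of_real x)) * Re (\<sigma> (of_real y))"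
      unfolding of_real_mult mult by (subst (1 2) re) simp
  qed (simp_all add: add one)
  with re have re': "\<sigma> (of_real r) = of_real r" for r by metis
  have "\<sigma> \<i> * \<sigma> \<i> = -1" using mult[of \<i> \<i>] re'[of "-1"] by simp
  then have "(\<sigma> \<i> - \<i>) * (\<sigma> \<i> + \<i>) = 0" by (simp add: algebra_simps)
  then have i: "\<sigma> \<i> = \<i> \<or> \<sigma> \<i> = - \<i>" by (auto simp: add_eq_0_iff2)
  have "\<sigma> x = of_real (Re x) + \<sigma> \<i> * of_real (Im x)" for x
    by (subst complex_eq[of x]) (simp add: add mult re')
  then have "\<sigma> \<i> = \<i> \<Longrightarrow> \<sigma> x = x" "\<sigma> \<i> = - \<i> \<Longrightarrow> \<sigma> x = cnj x" for x
    by (metis complex_eq, metis complex_cnj_add complex_cnj_complex_of_real complex_cnj_i complex_cnj_mult complex_eq)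
  with i show ?thesis by blast
qed

text \<open>The algebra has no unit, so constants and coordinate functions are not elements of it.
  They still act on it by multiplication, and the quotients by \<open>\<kappa> g\<close> that define
  \<sigma> and \<open>p'\<close> are the values which \<kappa> would take on them. The coordinate
  values are real and form the point \<open>p\<close>. Once the kernel of \<kappa> is known to
  vanish at \<open>p\<close>, \<kappa> and evaluation at \<open>p\<close> agree up to \<sigma> and
  one constant factor.\<close>

lemma schwartz_character:
  fixes \<kappa> :: "(real^'n::finite \<Rightarrow> complex) \<Rightarrow> complex"
  assumes add: "\<And>f g. f \<in> schwartz \<Longrightarrow> g \<in> schwartz \<Longrightarrow> \<kappa> (\<lambda>x. f x + g x) = \<kappa> f + \<kappa> g"
    and mult: "\<And>f g. f \<in> schwartz \<Longrightarrow> g \<in> schwartz \<Longrightarrow> \<kappa> (\<lambda>x. f x * g x) = \<kappa> f * \<kappa> g"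
    and cnj: "\<And>f. f \<in> schwartz \<Longrightarrow> \<kappa> (\<lambda>x. cnj (f x)) = cnj (\<kappa> f)"
    and g: "g \<in> schwartz" "\<kappa> g \<noteq> 0"
  shows "\<exists>p. (\<forall>f\<in>schwartz. \<kappa> f = f p) \<or> (\<forall>f\<in>schwartz. \<kappa> f = cnj (f p))"
proof -
  define \<sigma> where "\<sigma> c = \<kappa> (\<lambda>x. c * g x) / \<kappa> g" for c
  have scale: "\<kappa> (\<lambda>x. c * f x) = \<sigma> c * \<kappa> f" if f: "f \<in> schwartz" for c f
  proof -
    have "\<kappa> (\<lambda>x. c * f x) * \<kappa> g = \<kappa> (\<lambda>x. (c * f x) * g x)"
      by (intro mult[symmetric] schwartz_scale f g)
    also have "\<dots> = \<kappa> (\<lambda>x. f x * (c * g x))" by (simp add: ac_simps)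
    also have "\<dots> = \<kappa> f * \<kappa> (\<lambda>x. c * g x)"
      by (intro mult schwartz_scale f g)
    finally show ?thesis using g by (simp add: \<sigma>_def field_simps)
  qed
  have \<sigma>g: "\<sigma> c * \<kappa> g = \<kappa> (\<lambda>x. c * g x)" for c using g by (simp add: \<sigma>_def)
  have cases: "(\<forall>x. \<sigma> x = x) \<or> (\<forall>x. \<sigma> x = cnj x)"
  proof (rule complex_ring_hom_cases)
    fix c d
    have "\<sigma> (c + d) * \<kappa> g = (\<sigma> c + \<sigma> d) * \<kappa> g"
      using add[OF schwartz_scale[OF g(1), of c] schwartz_scale[OF g(1), of d]]
      by (simp add: \<sigma>g distrib_right)
    then show "\<sigma> (c + d) = \<sigma> c + \<sigma> d" using g by simp
    have "\<sigma> (c * d) * \<kappa> g = (\<sigma> c * \<sigma> d) * \<kappa> g"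
      using scale[OF schwartz_scale[OF g(1), of d], of c] by (simp add: \<sigma>g mult.assoc)
    then show "\<sigma> (c * d) = \<sigma> c * \<sigma> d" using g by simp
    show "\<sigma> 1 = 1" using g by (simp add: \<sigma>_def)
    have "\<sigma> (cnj c) * cnj (\<kappa> g) = cnj (\<kappa> (\<lambda>x. c * g x))"
      using scale[OF schwartz_cnj[OF g(1)], of "cnj c"] cnj[OF schwartz_scale[OF g(1), of c]] cnj[OF g(1)]
      by simp
    also have "\<dots> = cnj (\<sigma> c) * cnj (\<kappa> g)" by (simp flip: \<sigma>g)
    finally show "\<sigma> (cnj c) = cnj (\<sigma> c)" using g by simp
  qed
  then have \<sigma>_real: "\<sigma> (of_real r) = of_real r" for r by auto
  have \<sigma>_mult: "\<sigma> (c * d) = \<sigma> c * \<sigma> d" and \<sigma>_eq_0: "\<sigma> c = 0 \<longleftrightarrow> c = 0" for c d using cases by auto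
  have diff: "\<kappa> (\<lambda>x. f x - h x) = \<kappa> f - \<kappa> h" if "f \<in> schwartz" "h \<in> schwartz" for f h
    using add[OF that(1) schwartz_uminus[OF that(2)]] scale[OF that(2), of "-1"] \<sigma>_real[of "-1"] by simp
  have sum: "\<kappa> (\<lambda>x. \<Sum>i\<in>I. f i x) = (\<Sum>i\<in>I. \<kappa> (f i))"
    if "finite I" "I \<noteq> {}" "\<And>i. f i \<in> schwartz" for I :: "'n set" and f
    using that(1,2)
  proof (induction I rule: finite_ne_induct)
    case (insert i I)
    have "\<kappa> (\<lambda>x. f i x + (\<Sum>j\<in>I. f j x)) = \<kappa> (f i) + \<kappa> (\<lambda>x. \<Sum>j\<in>I. f j x)"
      using insert.hyps by (intro add schwartz_sum that) auto
    then show ?case using insert by simp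
  qed simp
  define p' where "p' j = \<kappa> (\<lambda>x. of_real (x $ j) * g x) / \<kappa> g" for j
  have coord: "\<kappa> (\<lambda>x. of_real (x $ j) * f x) = p' j * \<kappa> f" if f: "f \<in> schwartz" for j f
  proof -
    have "\<kappa> (\<lambda>x. of_real (x $ j) * f x) * \<kappa> g = \<kappa> (\<lambda>x. (of_real (x $ j) * f x) * g x)"
      by (intro mult[symmetric] schwartz_coord f g)
    also have "\<dots> = \<kappa> (\<lambda>x. f x * (of_real (x $ j) * g x))" by (simp add: ac_simps)
    also have "\<dots> = \<kappa> f * \<kappa> (\<lambda>x. of_real (x $ j) * g x)"
      by (intro mult schwartz_coord f g)
    finally show ?thesis using g by (simp add: p'_def field_simps)
  qed
  have p'_real: "p' j = of_real (Re (p' j))" for j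
  proof -
    have "p' j * cnj (\<kappa> g) = cnj (p' j * \<kappa> g)"
      using coord[OF schwartz_cnj[OF g(1)], of j] coord[OF g(1), of j] cnj[OF schwartz_coord[OF g(1), of j]] cnj[OF g(1)]
      by simp
    then have "p' j = cnj (p' j)" using g by simp
    then show ?thesis by (metis Reals_cnj_iff of_real_Re)
  qed
  define p :: "real^'n" where "p = (\<chi> j. Re (p' j))"
  have shift: "\<kappa> (\<lambda>x. of_real (x $ j - p $ j) * f x) = 0" if f: "f \<in> schwartz" for j f
  proof -
    have "\<kappa> (\<lambda>x. of_real (x $ j) * f x - of_real (p $ j) * f x) = p' j * \<kappa> f - of_real (p $ j) * \<kappa> f"
      by (simp add: diff schwartz_coord schwartz_scale f coord scale \<sigma>_real)
    also have "\<dots> = 0" using p'_real[of j] by (simp add: p_def)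
    finally show ?thesis by (simp add: left_diff_distrib)
  qed
  have ker: "f p = 0" if f: "f \<in> schwartz" and "\<kappa> f = 0" for f
  proof (rule ccontr)
    assume "f p \<noteq> 0"
    \<comment> \<open>The function \<open>w = \<bar>f\<bar>\<^sup>2 + \<bar>x - p\<bar>\<^sup>2\<close> is bounded away from \<open>0\<close>, so \<open>g = w * (g / w)\<close> would lie in the kernel.\<close>
    define w where "w x = f x * cnj (f x) + (\<Sum>j\<in>UNIV. of_real (x $ j - p $ j) * of_real (x $ j - p $ j))" for x
    define w' where "w' i x = (f x * cnj (partial i f x) + partial i f x * cnj (f x)) + of_real (2 * (x $ i - p $ i))" for i x
    have w_norm: "w x = of_real ((norm (f x))\<^sup>2 + (norm (x - p))\<^sup>2)" for x
      by (simp add: w_def complex_norm_square[symmetric] norm_vec_def L2_set_def sum_nonneg power2_eq_square[symmetric])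
    have cont_f: "continuous_on UNIV f" using schwartz_cont[OF f] .
    have w_cont: "continuous_on UNIV w"
      unfolding w_def[abs_def] by (intro continuous_intros cont_f)
    have w_pd: "has_pd i w (w' i)" for i
    proof -
      have "has_pd i (\<lambda>x. of_real ((norm (x - p))\<^sup>2)) (\<lambda>x. of_real (2 * (x $ i - p $ i)))"
        unfolding has_pd_def
      proof
        fix x
        have *: "(norm (x + t *\<^sub>R axis i 1 - p))\<^sup>2 = (norm (x - p))\<^sup>2 + 2 * t * (x $ i - p $ i) + t\<^sup>2" for t
          by (rule norm_shift_axis)
        have "((\<lambda>t. (norm (x - p))\<^sup>2 + 2 * t * (x $ i - p $ i) + t\<^sup>2) has_real_derivative 2 * (x $ i - p $ i)) (at 0)"
          by (auto intro!: derivative_eq_intros)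
        then show "((\<lambda>t. complex_of_real ((norm (x + t *\<^sub>R axis i 1 - p))\<^sup>2)) has_vector_derivative of_real (2 * (x $ i - p $ i))) (at 0)"
          unfolding * has_real_derivative_iff_has_vector_derivative
          by (rule bounded_linear.has_vector_derivative[OF bounded_linear_of_real])
      qed
      from has_pd_add[OF has_pd_mult[OF schwartz_pd(1)[OF f] has_pd_cnj[OF schwartz_pd(1)[OF f]]] this]
      have "has_pd i (\<lambda>x. f x * cnj (f x) + of_real ((norm (x - p))\<^sup>2)) (w' i)" by (simp add: w'_def[abs_def])
      moreover have "(\<lambda>x. f x * cnj (f x) + of_real ((norm (x - p))\<^sup>2)) = w"
        by (rule ext) (simp only: w_norm of_real_add complex_norm_square)
      ultimately show ?thesis by simp
    qed
    have w_mult: "(\<lambda>x. w x * h x) \<in> schwartz" if h: "h \<in> schwartz" for h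
    proof -
      have "(\<lambda>x. (f x * cnj (f x)) * h x + (\<Sum>j\<in>UNIV. of_real (x $ j - p $ j) * (of_real (x $ j - p $ j) * h x))) \<in> schwartz"
        by (intro schwartz_add schwartz_mult schwartz_cnj schwartz_sum schwartz_shift_coord f h) auto
      then show ?thesis by (simp add: w_def distrib_right sum_distrib_right mult.assoc)
    qed
    have w'_mult: "(\<lambda>x. w' i x * h x) \<in> schwartz" if h: "h \<in> schwartz" for i h
    proof -
      have "(\<lambda>x. (f x * cnj (partial i f x) + partial i f x * cnj (f x)) * h x + 2 * (of_real (x $ i - p $ i) * h x)) \<in> schwartz"
        by (intro schwartz_add schwartz_mult schwartz_cnj schwartz_scale schwartz_shift_coord schwartz_pd f h)
      then show ?thesis by (simp add: w'_def algebra_simps)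
    qed
    \<comment> \<open>\<open>w\<close> has no zero: at \<open>p\<close> the term from
      \<open>f\<close> is positive, elsewhere the distance term is. Outside the unit ball around
      \<open>p\<close> the distance term is at least 1; on the ball compactness gives a positive
      minimum.\<close>
    obtain \<delta> where \<delta>: "\<delta> > 0" "\<And>x. norm (w x) \<ge> \<delta>"
    proof -
      have "continuous_on (cball p 1) (\<lambda>x. norm (w x))"
        by (intro continuous_intros continuous_on_subset[OF w_cont]) auto
      then obtain y where y: "\<And>x. x \<in> cball p 1 \<Longrightarrow> norm (w y) \<le> norm (w x)"
        using continuous_attains_inf[of "cball p 1" "\<lambda>x. norm (w x)"] by fastforce
      have n: "norm (w x) = (norm (f x))\<^sup>2 + (norm (x - p))\<^sup>2" for x
        unfolding w_norm norm_of_real by simp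
      have "norm (w y) > 0"
        using \<open>f p \<noteq> 0\<close> unfolding n by (cases "y = p") (auto intro: add_nonneg_pos)
      moreover have "norm (w x) \<ge> min 1 (norm (w y))" for x
      proof (cases "x \<in> cball p 1")
        case False
        then have "1 \<le> norm (x - p)" by (simp add: dist_norm norm_minus_commute)
        then have "1 \<le> (norm (x - p))\<^sup>2" by (simp add: one_le_power)
        then show ?thesis unfolding n by (smt (verit) zero_le_power2)
      qed (use y in fastforce)
      ultimately show ?thesis by (intro that[of "min 1 (norm (w y))"]) auto
    qed
    define h where "h x = g x / w x" for x
    have h: "h \<in> schwartz"
      unfolding h_def[abs_def] using w_cont w_pd w_mult w'_mult \<delta> by (rule schwartz_divide[OF g(1)])
    have "w x \<noteq> 0" for x using \<delta>(1) \<delta>(2)[of x] by auto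
    then have "g = (\<lambda>x. w x * h x)" by (simp add: h_def)
    also have "\<dots> = (\<lambda>x. f x * (cnj (f x) * h x) + (\<Sum>j\<in>UNIV. of_real (x $ j - p $ j) * (of_real (x $ j - p $ j) * h x)))"
      by (simp only: w_def distrib_right sum_distrib_right mult.assoc)
    finally have "\<kappa> g = \<kappa> (\<lambda>x. f x * (cnj (f x) * h x)
        + (\<Sum>j\<in>UNIV. of_real (x $ j - p $ j) * (of_real (x $ j - p $ j) * h x)))" by (rule arg_cong)
    also have "\<dots> = \<kappa> (\<lambda>x. f x * (cnj (f x) * h x))
        + (\<Sum>j\<in>UNIV. \<kappa> (\<lambda>x. of_real (x $ j - p $ j) * (of_real (x $ j - p $ j) * h x)))"
    proof (subst sum[symmetric])
      show "(\<lambda>x. of_real (x $ j - p $ j) * (of_real (x $ j - p $ j) * h x)) \<in> schwartz" for j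
        by (intro schwartz_shift_coord h)
      then show "\<kappa> (\<lambda>x. f x * (cnj (f x) * h x)
            + (\<Sum>j\<in>UNIV. of_real (x $ j - p $ j) * (of_real (x $ j - p $ j) * h x)))
          = \<kappa> (\<lambda>x. f x * (cnj (f x) * h x))
            + \<kappa> (\<lambda>x. \<Sum>j\<in>UNIV. of_real (x $ j - p $ j) * (of_real (x $ j - p $ j) * h x))"
        by (intro add[OF schwartz_mult[OF f schwartz_mult[OF schwartz_cnj[OF f] h]] schwartz_sum]) auto
    qed auto
    also have "\<dots> = 0"
      using mult[OF f schwartz_mult[OF schwartz_cnj[OF f] h]] shift[OF schwartz_shift_coord[OF h]] \<open>\<kappa> f = 0\<close> by simp
    finally show False using g by simp
  qed
  define k where "k = \<sigma> (g p) / \<kappa> g"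
  have eq: "\<sigma> (f p) = k * \<kappa> f" if f: "f \<in> schwartz" for f
  proof -
    \<comment> \<open>\<sigma> is the identity or conjugation, hence its own inverse, and
      \<open>a\<close> is the preimage of \<open>\<kappa> f / \<kappa> g\<close>. Then
      \<open>f - a * g\<close> lies in the kernel, so \<open>f p = a * g p\<close>; applying
      \<sigma> gives a ratio between \<open>\<sigma> (f p)\<close> and \<open>\<kappa> f\<close>
      independent of \<open>f\<close>.\<close>
    define a where "a = (if \<forall>x. \<sigma> x = x then \<kappa> f / \<kappa> g else cnj (\<kappa> f / \<kappa> g))"
    have a: "\<sigma> a = \<kappa> f / \<kappa> g" unfolding a_def using cases by auto
    have "\<kappa> (\<lambda>x. f x - a * g x) = 0"
      using g by (simp add: diff f schwartz_scale scale a)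
    from ker[OF _ this] have "f p = a * g p"
      using schwartz_diff[OF f schwartz_scale[OF g(1)]] by simp
    then show ?thesis by (simp add: \<sigma>_mult a k_def)
  qed
  let ?G = "gaussian p 1"
  have G: "?G \<in> schwartz" by (rule gaussian_schwartz) simp
  have "\<sigma> (?G p) \<noteq> 0" by (simp add: \<sigma>_eq_0 gaussian_def)
  \<comment> \<open>The left-hand side is \<sigma> of the squared Gaussian at \<open>p\<close>, the
    right-hand side the square of \<sigma> of the Gaussian at \<open>p\<close>. As
    \<open>k * \<kappa> ?G\<close> is nonzero, multiplicativity fixes the constant.\<close>
  moreover have "k * (\<kappa> ?G * \<kappa> ?G) = (k * \<kappa> ?G) * (k * \<kappa> ?G)"
    using eq[OF schwartz_mult[OF G G]] by (simp add: mult[OF G G] \<sigma>_mult eq[OF G])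
  ultimately have "k = 1" using eq[OF G] by auto
  with eq have "\<kappa> f = \<sigma> (f p)" if "f \<in> schwartz" for f using that by simp
  with cases show ?thesis by metis
qed

section \<open>Linear change of variables\<close>

lemma nn_integral_lborel_translate:
  fixes f :: "'a::euclidean_space \<Rightarrow> ennreal"
  assumes [measurable]: "f \<in> borel_measurable borel"
  shows "(\<integral>\<^sup>+x. f (x + c) \<partial>lborel) = (\<integral>\<^sup>+x. f x \<partial>lborel)"
proof -
  have "(\<integral>\<^sup>+x. f x \<partial>lborel) = (\<integral>\<^sup>+x. f x \<partial>distr lborel borel ((+) c))"
    by (simp add: lborel_distr_plus)
  also have "\<dots> = (\<integral>\<^sup>+x. f (x + c) \<partial>lborel)"
    by (subst nn_integral_distr) (auto simp: add.commute)
  finally show ?thesis by simp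
qed

text \<open>The rank-one update below acts on each line in direction \<open>e\<close> as an affine map of slope \<open>1 + e \<bullet> a\<close>.
  Averaging along such lines reduces it to the one-dimensional substitution rule.  The change of
  variables theorems of the library need a well-ordered index type and do not apply.\<close>

lemma nn_integral_average_line:
  fixes f :: "'a::euclidean_space \<Rightarrow> ennreal"
  assumes f[measurable]: "f \<in> borel_measurable borel" and "e \<noteq> 0"
  shows "(\<integral>\<^sup>+x. (\<integral>\<^sup>+t. f (x + t *\<^sub>R e) \<partial>lborel) * indicator {0..1} (x \<bullet> e / (e \<bullet> e)) \<partial>lborel) = (\<integral>\<^sup>+x. f x \<partial>lborel)"
proof -
  \<comment> \<open>The slab cut out by the indicator meets every line in direction \<open>e\<close>
    in a parameter interval of length one. Integrating along the lines and then over the slab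
    therefore counts \<open>f\<close> exactly once.\<close>
  let ?K = "indicator {0..1::real} :: real \<Rightarrow> ennreal"
  have "(\<integral>\<^sup>+x. (\<integral>\<^sup>+t. f (x + t *\<^sub>R e) \<partial>lborel) * ?K (x \<bullet> e / (e \<bullet> e)) \<partial>lborel)
      = (\<integral>\<^sup>+x. (\<integral>\<^sup>+t. f (x + t *\<^sub>R e) * ?K (x \<bullet> e / (e \<bullet> e)) \<partial>lborel) \<partial>lborel)"
    by (intro nn_integral_cong nn_integral_multc[symmetric]) measurable
  also have "\<dots> = (\<integral>\<^sup>+t. (\<integral>\<^sup>+x. f (x + t *\<^sub>R e) * ?K (x \<bullet> e / (e \<bullet> e)) \<partial>lborel) \<partial>lborel)"
    by (rule lborel_pair.Fubini'[symmetric]) measurable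
  also have "\<dots> = (\<integral>\<^sup>+t. (\<integral>\<^sup>+x. f x * ?K (x \<bullet> e / (e \<bullet> e) - t) \<partial>lborel) \<partial>lborel)"
  proof (rule nn_integral_cong)
    fix t :: real
    have "(\<integral>\<^sup>+x. f x * ?K (x \<bullet> e / (e \<bullet> e) - t) \<partial>lborel)
        = (\<integral>\<^sup>+x. f (x + t *\<^sub>R e) * ?K ((x + t *\<^sub>R e) \<bullet> e / (e \<bullet> e) - t) \<partial>lborel)"
      by (rule nn_integral_lborel_translate[symmetric]) measurable
    then show "(\<integral>\<^sup>+x. f (x + t *\<^sub>R e) * ?K (x \<bullet> e / (e \<bullet> e)) \<partial>lborel)
        = (\<integral>\<^sup>+x. f x * ?K (x \<bullet> e / (e \<bullet> e) - t) \<partial>lborel)"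
      using \<open>e \<noteq> 0\<close> by (simp add: inner_add_left add_divide_distrib)
  qed
  also have "\<dots> = (\<integral>\<^sup>+x. (\<integral>\<^sup>+t. f x * ?K (x \<bullet> e / (e \<bullet> e) - t) \<partial>lborel) \<partial>lborel)"
    by (rule lborel_pair.Fubini') measurable
  also have "\<dots> = (\<integral>\<^sup>+x. f x \<partial>lborel)"
  proof (rule nn_integral_cong)
    fix x
    let ?m = "x \<bullet> e / (e \<bullet> e)"
    have "(\<integral>\<^sup>+t. f x * ?K (?m - t) \<partial>lborel) = f x * (\<integral>\<^sup>+t. indicator {?m - 1..?m} t \<partial>lborel)"
      by (subst nn_integral_cmult[symmetric]) (auto intro!: nn_integral_cong simp: indicator_def)
    then show "(\<integral>\<^sup>+t. f x * ?K (?m - t) \<partial>lborel) = f x" by simp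
  qed
  finally show ?thesis .
qed

lemma nn_integral_rank_one_update:
  fixes f :: "'a::euclidean_space \<Rightarrow> ennreal"
  assumes f[measurable]: "f \<in> borel_measurable borel" and "1 + e \<bullet> a \<noteq> 0"
  shows "ennreal \<bar>1 + e \<bullet> a\<bar> * (\<integral>\<^sup>+x. f (x + (x \<bullet> a) *\<^sub>R e) \<partial>lborel) = (\<integral>\<^sup>+x. f x \<partial>lborel)"
proof (cases "e = 0")
  case False
  let ?K = "\<lambda>x. indicator {0..1} (x \<bullet> e / (e \<bullet> e)) :: ennreal" and ?c = "1 + e \<bullet> a"
  have "ennreal \<bar>?c\<bar> * (\<integral>\<^sup>+x. f (x + (x \<bullet> a) *\<^sub>R e) \<partial>lborel)
      = ennreal \<bar>?c\<bar> * (\<integral>\<^sup>+x. (\<integral>\<^sup>+t. f (x + t *\<^sub>R e + ((x + t *\<^sub>R e) \<bullet> a) *\<^sub>R e) \<partial>lborel) * ?K x \<partial>lborel)"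
    by (subst nn_integral_average_line[OF _ False]) auto
  also have "\<dots> = (\<integral>\<^sup>+x. ennreal \<bar>?c\<bar> * ((\<integral>\<^sup>+t. f (x + t *\<^sub>R e + ((x + t *\<^sub>R e) \<bullet> a) *\<^sub>R e) \<partial>lborel) * ?K x) \<partial>lborel)"
    by (rule nn_integral_cmult[symmetric]) measurable
  also have "\<dots> = (\<integral>\<^sup>+x. (\<integral>\<^sup>+t. f (x + t *\<^sub>R e) \<partial>lborel) * ?K x \<partial>lborel)"
  proof (rule nn_integral_cong)
    fix x
    have "(\<integral>\<^sup>+t. f (x + t *\<^sub>R e) \<partial>lborel) = ennreal \<bar>?c\<bar> * (\<integral>\<^sup>+t. f (x + (x \<bullet> a + ?c * t) *\<^sub>R e) \<partial>lborel)"
      using assms by (intro nn_integral_real_affine) measurable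
    also have "(\<lambda>t. f (x + (x \<bullet> a + ?c * t) *\<^sub>R e)) = (\<lambda>t. f (x + t *\<^sub>R e + ((x + t *\<^sub>R e) \<bullet> a) *\<^sub>R e))"
      by (rule ext, rule arg_cong[of _ _ f]) (simp add: algebra_simps inner_add_left)
    finally show "ennreal \<bar>?c\<bar> * ((\<integral>\<^sup>+t. f (x + t *\<^sub>R e + ((x + t *\<^sub>R e) \<bullet> a) *\<^sub>R e) \<partial>lborel) * ?K x)
        = (\<integral>\<^sup>+t. f (x + t *\<^sub>R e) \<partial>lborel) * ?K x"
      by (simp add: mult.assoc)
  qed
  also have "\<dots> = (\<integral>\<^sup>+x. f x \<partial>lborel)" by (rule nn_integral_average_line[OF f False])
  finally show ?thesis .
qed simp

lemma prod_Basis_cart: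
  fixes f :: "real^'n::finite \<Rightarrow> 'b::comm_monoid_mult"
  shows "(\<Prod>b\<in>Basis. f b) = (\<Prod>i\<in>UNIV. f (axis i 1))"
proof -
  have "(\<Prod>b\<in>range (\<lambda>i. axis i 1 :: real^'n). f b) = (\<Prod>i\<in>UNIV. f (axis i 1))"
    by (subst prod.reindex) (auto simp: inj_on_def axis_eq_axis)
  moreover have "(Basis :: (real^'n) set) = range (\<lambda>i. axis i 1)" by (auto simp: Basis_vec_def)
  ultimately show ?thesis by simp
qed

lemma matrix_vector_mult_measurable [measurable]: "(\<lambda>x::real^'n::finite. A *v x) \<in> borel_measurable borel"
  by (intro borel_measurable_continuous_onI linear_continuous_on linear_linear[THEN iffD2] matrix_vector_mul_linear)

text \<open>Induction over elementary matrices: a zero row contradicts the nonzero determinant, a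
  diagonal matrix rescales the axes, and both swaps and shears are rank-one updates of the
  identity.\<close>

lemma nn_integral_linear_change:
  fixes A :: "real^'n::finite^'n" and f :: "real^'n \<Rightarrow> ennreal"
  assumes "f \<in> borel_measurable borel" "det A \<noteq> 0"
  shows "ennreal \<bar>det A\<bar> * (\<integral>\<^sup>+x. f (A *v x) \<partial>lborel) = (\<integral>\<^sup>+x. f x \<partial>lborel)"
proof -
  have rank_one: "ennreal \<bar>det A\<bar> * (\<integral>\<^sup>+x. f (A *v x) \<partial>lborel) = (\<integral>\<^sup>+x. f x \<partial>lborel)"
    if f: "f \<in> borel_measurable borel" and A: "\<And>x. A *v x = x + (x \<bullet> a) *\<^sub>R e" and d: "\<bar>det A\<bar> = \<bar>1 + e \<bullet> a\<bar>" "det A \<noteq> 0"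
    for f :: "real^'n \<Rightarrow> ennreal" and A a e
    using nn_integral_rank_one_update[OF f, of e a] d by (simp add: A)
  have "\<forall>f \<in> borel_measurable borel. det A \<noteq> 0 \<longrightarrow>
      ennreal \<bar>det A\<bar> * (\<integral>\<^sup>+x. f (A *v x) \<partial>lborel) = (\<integral>\<^sup>+x. f x \<partial>lborel)"
  proof (induction A rule: induct_matrix_elementary; intro ballI impI)
    fix A B :: "real^'n^'n" and f :: "real^'n \<Rightarrow> ennreal"
    assume A: "\<forall>f \<in> borel_measurable borel. det A \<noteq> 0 \<longrightarrow>
      ennreal \<bar>det A\<bar> * (\<integral>\<^sup>+x. f (A *v x) \<partial>lborel) = (\<integral>\<^sup>+x. f x \<partial>lborel)"
    and B: "\<forall>f \<in> borel_measurable borel. det B \<noteq> 0 \<longrightarrow>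
      ennreal \<bar>det B\<bar> * (\<integral>\<^sup>+x. f (B *v x) \<partial>lborel) = (\<integral>\<^sup>+x. f x \<partial>lborel)"
    and f[measurable]: "f \<in> borel_measurable borel" and d: "det (A ** B) \<noteq> 0"
    have "ennreal \<bar>det (A ** B)\<bar> * (\<integral>\<^sup>+x. f ((A ** B) *v x) \<partial>lborel)
        = ennreal \<bar>det A\<bar> * (ennreal \<bar>det B\<bar> * (\<integral>\<^sup>+x. f (A *v (B *v x)) \<partial>lborel))"
      by (simp add: det_mul abs_mult ennreal_mult mult.assoc matrix_vector_mul_assoc)
    also have "ennreal \<bar>det B\<bar> * (\<integral>\<^sup>+x. f (A *v (B *v x)) \<partial>lborel) = (\<integral>\<^sup>+x. f (A *v x) \<partial>lborel)"
      using B[THEN bspec, of "\<lambda>x. f (A *v x)"] d by (simp add: det_mul)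
    also have "ennreal \<bar>det A\<bar> * \<dots> = (\<integral>\<^sup>+x. f x \<partial>lborel)"
      using A f d by (simp add: det_mul)
    finally show "ennreal \<bar>det (A ** B)\<bar> * (\<integral>\<^sup>+x. f ((A ** B) *v x) \<partial>lborel) = (\<integral>\<^sup>+x. f x \<partial>lborel)" .
  next
    fix A :: "real^'n^'n" and i and f :: "real^'n \<Rightarrow> ennreal"
    assume "row i A = 0" "det A \<noteq> 0"
    then show "ennreal \<bar>det A\<bar> * (\<integral>\<^sup>+x. f (A *v x) \<partial>lborel) = (\<integral>\<^sup>+x. f x \<partial>lborel)"
      using det_zero_row(2)[of i A] by simp
  next
    fix A :: "real^'n^'n" and f :: "real^'n \<Rightarrow> ennreal"
    assume diag: "\<And>i j. i \<noteq> j \<Longrightarrow> A $ i $ j = 0" and [measurable]: "f \<in> borel_measurable borel" and d: "det A \<noteq> 0"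
    have det: "det A = (\<Prod>i\<in>UNIV. A $ i $ i)" by (rule det_diagonal[OF diag])
    define c where "c b = (A *v b) \<bullet> b" for b :: "real^'n"
    have c: "c (axis i 1) = A $ i $ i" for i
      by (simp add: c_def inner_axis matrix_vector_mult_basis column_def)
    have nz: "c b \<noteq> 0" if "b \<in> Basis" for b
      using that d by (auto simp: det Basis_vec_def c)
    define S where "S x = 0 + (\<Sum>b\<in>Basis. (c b * (x \<bullet> b)) *\<^sub>R b)" for x :: "real^'n"
    have S: "S x = A *v x" for x
    proof (rule euclidean_eqI)
      fix b :: "real^'n" assume b: "b \<in> Basis"
      then obtain i where i: "b = axis i 1" by (auto simp: Basis_vec_def)
      have "S x \<bullet> b = c b * (x \<bullet> b)" using b by (simp add: S_def inner_sum_left_Basis)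
      also have "\<dots> = (A *v x) \<bullet> b"
        using diag by (simp add: i c inner_axis matrix_vector_mult_def sum.remove[of UNIV i] )
      finally show "S x \<bullet> b = (A *v x) \<bullet> b" .
    qed
    have [measurable]: "S \<in> borel_measurable borel" unfolding S[abs_def] by measurable
    have "(lborel :: (real^'n) measure) = density (distr lborel borel S) (\<lambda>_. (\<Prod>b\<in>Basis. \<bar>c b\<bar>))"
      unfolding S_def[abs_def] by (rule lborel_affine_euclidean) (use nz in auto)
    also have "(\<Prod>b\<in>Basis. \<bar>c b\<bar>) = \<bar>det A\<bar>" by (simp add: prod_Basis_cart c det abs_prod)
    finally have "(\<integral>\<^sup>+x. f x \<partial>lborel) = (\<integral>\<^sup>+x. f x \<partial>density (distr lborel borel S) (\<lambda>_. \<bar>det A\<bar>))" by simp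
    also have "\<dots> = ennreal \<bar>det A\<bar> * (\<integral>\<^sup>+x. f (A *v x) \<partial>lborel)"
      by (simp add: nn_integral_density nn_integral_distr nn_integral_cmult S)
    finally show "ennreal \<bar>det A\<bar> * (\<integral>\<^sup>+x. f (A *v x) \<partial>lborel) = (\<integral>\<^sup>+x. f x \<partial>lborel)" by simp
  next
    fix m n :: 'n and f :: "real^'n \<Rightarrow> ennreal"
    let ?A = "(\<chi> i j. mat 1 $ i $ Transposition.transpose m n j) :: real^'n^'n"
    \<comment> \<open>Swapping two coordinates is the reflection in the hyperplane orthogonal to
      \<open>?e\<close>. Since \<open>?e \<bullet> ?e\<close> is 2, it is the rank-one update with
      \<open>a = - ?e\<close>, of slope -1.\<close>
    let ?e = "axis m 1 - axis n 1 :: real^'n"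
    assume mn: "m \<noteq> n" and f: "f \<in> borel_measurable borel" and d: "det ?A \<noteq> 0"
    show "ennreal \<bar>det ?A\<bar> * (\<integral>\<^sup>+x. f (?A *v x) \<partial>lborel) = (\<integral>\<^sup>+x. f x \<partial>lborel)"
    proof (rule rank_one[OF f _ _ d])
      have "det ?A = of_int (sign (Transposition.transpose m n)) * det (mat 1 :: real^'n^'n)"
        by (rule det_permute_columns) (simp add: permutes_swap_id)
      then have "\<bar>det ?A\<bar> = 1" using mn by (simp add: sign_swap_id)
      moreover have "?e \<bullet> (- ?e) = - 2"
        using mn by (simp add: inner_diff_left inner_diff_right inner_axis_axis)
      ultimately show "\<bar>det ?A\<bar> = \<bar>1 + ?e \<bullet> (- ?e)\<bar>" by simp
      show "?A *v x = x + (x \<bullet> (- ?e)) *\<^sub>R ?e" for x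
      proof (rule vec_eq_iff[THEN iffD2], rule allI)
        fix i
        have "(?A *v x) $ i = (\<Sum>j\<in>UNIV. if j = Transposition.transpose m n i then x $ j else 0)"
          unfolding matrix_vector_mult_def vec_lambda_beta
          by (intro sum.cong refl) (auto simp: mat_def Transposition.transpose_def)
        also have "\<dots> = x $ Transposition.transpose m n i" by simp
        also have "\<dots> = (x + (x \<bullet> (- ?e)) *\<^sub>R ?e) $ i"
        proof -
          have "x \<bullet> (- ?e) = x $ n - x $ m" by (simp add: inner_diff_right inner_axis)
          then show ?thesis using mn by (simp only:) (simp add: axis_def Transposition.transpose_def)
        qed
        finally show "(?A *v x) $ i = (x + (x \<bullet> (- ?e)) *\<^sub>R ?e) $ i" .
      qed
    qed
  next
    fix m n :: 'n and c :: real and f :: "real^'n \<Rightarrow> ennreal"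
    let ?A = "(\<chi> i j. if i = m \<and> j = n then c else of_bool (i = j)) :: real^'n^'n"
    let ?e = "axis m 1 :: real^'n"
    assume mn: "m \<noteq> n" and f: "f \<in> borel_measurable borel" and d: "det ?A \<noteq> 0"
    show "ennreal \<bar>det ?A\<bar> * (\<integral>\<^sup>+x. f (?A *v x) \<partial>lborel) = (\<integral>\<^sup>+x. f x \<partial>lborel)"
    proof (rule rank_one[OF f _ _ d])
      have "?A = (\<chi> k. if k = m then row m (mat 1) + c *s row n (mat 1) else row k (mat 1))"
        using mn by (auto simp: vec_eq_iff row_def mat_def)
      then have "det ?A = 1" using det_row_operation[OF mn, of "mat 1" c] by simp
      moreover have "?e \<bullet> (c *\<^sub>R axis n 1) = 0" using mn by (simp add: inner_axis_axis)
      ultimately show "\<bar>det ?A\<bar> = \<bar>1 + ?e \<bullet> (c *\<^sub>R axis n 1)\<bar>" by simp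
      show "?A *v x = x + (x \<bullet> (c *\<^sub>R axis n 1)) *\<^sub>R ?e" for x
      proof (rule vec_eq_iff[THEN iffD2], rule allI)
        fix i
        have "(?A *v x) $ i = (\<Sum>j\<in>UNIV. (if j = i then x $ j else 0) + (if j = n then if i = m then c * x $ j else 0 else 0))"
          unfolding matrix_vector_mult_def vec_lambda_beta using mn by (intro sum.cong refl) auto
        also have "\<dots> = (x + (x \<bullet> (c *\<^sub>R axis n 1)) *\<^sub>R ?e) $ i"
        proof -
          have "x \<bullet> (c *\<^sub>R axis n 1) = c * x $ n" by (simp add: inner_axis)
          then show ?thesis by (simp only: sum.distrib) (simp add: axis_def)
        qed
        finally show "(?A *v x) $ i = (x + (x \<bullet> (c *\<^sub>R axis n 1)) *\<^sub>R ?e) $ i" .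
      qed
    qed
  qed
  with assms show ?thesis by blast
qed

section \<open>Fourier integrals\<close>

lemma
  fixes g :: "'n::finite \<Rightarrow> real \<Rightarrow> complex"
  assumes g: "\<And>i. integrable lborel (g i)"
  shows integrable_prod_cart: "integrable lborel (\<lambda>x::real^'n. \<Prod>i\<in>UNIV. g i (x $ i))"
    and integral_prod_cart: "(LINT x|lborel. (\<Prod>i\<in>UNIV. g i ((x::real^'n) $ i))) = (\<Prod>i\<in>UNIV. LINT t|lborel. g i t)"
proof -
  interpret product_sigma_finite "\<lambda>_::real^'n. lborel :: real measure" ..
  \<comment> \<open>The product measure is indexed by basis vectors, the family \<open>g\<close> by
    coordinates; \<open>ix\<close> recovers a coordinate from its axis vector.\<close>
  define ix where "ix b = (THE i. b = axis i 1)" for b :: "real^'n"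
  have ix: "ix (axis i 1) = i" for i by (simp add: ix_def axis_eq_axis)
  have gm[measurable]: "g i \<in> borel_measurable borel" for i using g[of i] by (auto dest: borel_measurable_integrable)
  let ?V = "\<lambda>f. \<Sum>b\<in>Basis. f b *\<^sub>R (b :: real^'n)"
  have eq: "(\<Prod>i\<in>UNIV. g i (?V f $ i)) = (\<Prod>b\<in>Basis. g (ix b) (f b))" for f
  proof -
    have "?V f $ i = f (axis i 1)" for i
    proof -
      have "?V f $ i = ?V f \<bullet> axis i 1" by (simp add: inner_axis)
      also have "\<dots> = f (axis i 1)" by (rule inner_sum_left_Basis) (simp add: axis_in_Basis_iff)
      finally show ?thesis .
    qed
    then show ?thesis by (simp add: prod_Basis_cart ix)
  qed
  have V[measurable]: "?V \<in> measurable (\<Pi>\<^sub>M b\<in>Basis. lborel) borel" by measurable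
  have m[measurable]: "(\<lambda>x::real^'n. \<Prod>i\<in>UNIV. g i (x $ i)) \<in> borel_measurable borel" by measurable
  show "integrable lborel (\<lambda>x::real^'n. \<Prod>i\<in>UNIV. g i (x $ i))"
    by (subst lborel_eq, subst integrable_distr_eq[OF V m], simp only: eq, rule product_integrable_prod) (auto intro: g)
  have "(LINT x|lborel. (\<Prod>i\<in>UNIV. g i ((x::real^'n) $ i))) = (LINT f|(\<Pi>\<^sub>M b\<in>(Basis::(real^'n) set). lborel). (\<Prod>b\<in>Basis. g (ix b) (f b)))"
    unfolding eq[symmetric] by (subst lborel_eq) (rule integral_distr[OF V m])
  also have "\<dots> = (\<Prod>b\<in>(Basis::(real^'n) set). LINT t|lborel. g (ix b) t)"
    by (rule product_integral_prod) (auto intro: g)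
  finally show "(LINT x|lborel. (\<Prod>i\<in>UNIV. g i ((x::real^'n) $ i))) = (\<Prod>i\<in>UNIV. LINT t|lborel. g i t)"
    by (simp add: prod_Basis_cart ix)
qed

text \<open>The majorant is a product of the one-dimensional integrable functions
  \<open>1 / (1 + t^2)\<close>. Its denominator has degree two in each coordinate, hence the
  exponent \<open>?N\<close>, which is twice the dimension.\<close>

lemma decaying_integrable:
  fixes f :: "real^'n::finite \<Rightarrow> complex"
  assumes cont: "continuous_on UNIV f" and dec: "decaying f"
  shows "integrable lborel f"
proof -
  let ?N = "\<Sum>i\<in>(UNIV::'n set). 2::nat"
  obtain C where C: "C > 0" "\<And>x. norm (f x) * (1 + norm x) ^ ?N \<le> C" using dec by (metis decayingE)
  have i1: "integrable lborel (\<lambda>t::real. complex_of_real (inverse (1 + t\<^sup>2)))"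
    using integrable_inverse_1_plus_square by (intro integrable_of_real) (simp add: set_integrable_def)
  have "integrable lborel (\<lambda>x::real^'n. of_real C * (\<Prod>i\<in>UNIV. complex_of_real (inverse (1 + (x $ i)\<^sup>2))))"
    by (intro integrable_mult_right integrable_prod_cart i1)
  then show ?thesis
  proof (rule Bochner_Integration.integrable_bound)
    show "f \<in> borel_measurable lborel" using cont by (simp add: borel_measurable_continuous_onI)
    have "norm (f x) \<le> norm (of_real C * (\<Prod>i\<in>UNIV. complex_of_real (inverse (1 + (x $ i)\<^sup>2))))" for x
    proof -
      have pos: "(\<Prod>i\<in>UNIV. 1 + (x $ i)\<^sup>2) > 0" by (intro prod_pos) (auto intro: add_pos_nonneg)
      have "(\<Prod>i\<in>UNIV. 1 + (x $ i)\<^sup>2) \<le> (\<Prod>i\<in>(UNIV::'n set). (1 + norm x) ^ 2)"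
      proof (rule prod_mono, safe)
        fix i
        have "(x $ i)\<^sup>2 \<le> (norm x)\<^sup>2"
          using component_le_norm_cart[of x i] by (metis abs_le_square_iff abs_norm_cancel real_norm_def)
        also have "1 + \<dots> \<le> (1 + norm x)\<^sup>2" by (simp add: power2_sum)
        finally show "1 + (x $ i)\<^sup>2 \<le> (1 + norm x)\<^sup>2" by simp
      qed (auto intro: add_nonneg_nonneg)
      also have "\<dots> = (1 + norm x) ^ ?N" by (simp add: mult.commute flip: power_mult)
      finally have "norm (f x) * (\<Prod>i\<in>UNIV. 1 + (x $ i)\<^sup>2) \<le> norm (f x) * (1 + norm x) ^ ?N"
        by (rule mult_left_mono) simp
      then have "norm (f x) * (\<Prod>i\<in>UNIV. 1 + (x $ i)\<^sup>2) \<le> C" using C(2)[of x] by linarith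
      then have "norm (f x) \<le> C * inverse (\<Prod>i\<in>UNIV. 1 + (x $ i)\<^sup>2)"
        using pos by (simp add: field_simps)
      also have "\<dots> = norm (of_real C * (\<Prod>i\<in>UNIV. complex_of_real (inverse (1 + (x $ i)\<^sup>2))))"
        using C(1) by (simp only: norm_mult prod_norm[symmetric] norm_of_real abs_inverse prod_inversef[symmetric])
          (auto intro!: prod.cong simp: abs_of_nonneg add_nonneg_nonneg)
      finally show ?thesis .
    qed
    then show "AE x in lborel. norm (f x) \<le> norm (of_real C * (\<Prod>i\<in>UNIV. complex_of_real (inverse (1 + (x $ i)\<^sup>2))))" by simp
  qed
qed

lemma schwartz_integrable: "f \<in> schwartz \<Longrightarrow> integrable lborel f"
  by (intro decaying_integrable schwartz_cont schwartz_decaying)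

text \<open>For \<open>s = 1\<close> this is the characteristic function of the standard normal
  distribution; rescaling by \<open>sqrt s\<close> gives the other variances.\<close>

lemma has_bochner_integral_gaussian_character_1:
  assumes s: "s > 0"
  shows "has_bochner_integral lborel (\<lambda>x. exp (\<i> * of_real (x * t)) * of_real (exp (- x\<^sup>2 / (2 * s))))
     (complex_of_real (sqrt (2 * pi * s) * exp (- s * t\<^sup>2 / 2)))"
proof -
  let ?r = "sqrt s"
  have r: "?r > 0" "?r * ?r = s" using s by auto
  have std: "has_bochner_integral lborel (\<lambda>x. exp (\<i> * of_real (x * u)) * of_real (exp (- x\<^sup>2 / 2)))
     (complex_of_real (sqrt (2 * pi) * exp (- u\<^sup>2 / 2)))" for u
  proof -
    have "integrable lborel std_normal_density" by (rule integrable_normal_density) simp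
    then have "integrable lborel (\<lambda>x. complex_of_real (std_normal_density x) * iexp (u * x))"
      by (rule Bochner_Integration.integrable_bound) (auto simp: norm_mult)
    moreover have "(LINT x|lborel. complex_of_real (std_normal_density x) * iexp (u * x)) = of_real (exp (- u\<^sup>2 / 2))"
    proof -
      have "(LINT x|lborel. complex_of_real (std_normal_density x) * iexp (u * x)) = char std_normal_distribution u"
        unfolding char_def by (subst integral_density) (auto simp: scaleR_conv_of_real)
      then show ?thesis by (simp add: char_std_normal_distribution)
    qed
    ultimately have "has_bochner_integral lborel (\<lambda>x. complex_of_real (std_normal_density x) * iexp (u * x)) (of_real (exp (- u\<^sup>2 / 2)))"
      by (simp add: has_bochner_integral_iff)
    then have "has_bochner_integral lborel (\<lambda>x. of_real (sqrt (2 * pi)) * (complex_of_real (std_normal_density x) * iexp (u * x)))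
        (of_real (sqrt (2 * pi)) * of_real (exp (- u\<^sup>2 / 2)))"
      by (intro has_bochner_integral_mult_right) auto
    then show ?thesis
      by (simp add: std_normal_density_def mult_ac)
  qed
  have "has_bochner_integral lborel (\<lambda>x. exp (\<i> * of_real (x * t)) * of_real (exp (- x\<^sup>2 / (2 * s))))
     (complex_of_real (?r * (sqrt (2 * pi) * exp (- (t * ?r)\<^sup>2 / 2))))"
  proof (subst lborel_has_bochner_integral_real_affine_iff[of ?r _ _ 0])
    have 1: "- (0 + ?r * x)\<^sup>2 / (2 * s) = - x\<^sup>2 / 2" "(0 + ?r * x) * t = x * (t * ?r)" for x
      using s by (simp_all add: power_mult_distrib)
    have 2: "complex_of_real (?r * y) /\<^sub>R \<bar>?r\<bar> = of_real y" for y
      using s by (simp add: scaleR_conv_of_real)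
    show "has_bochner_integral lborel (\<lambda>x. exp (\<i> * of_real ((0 + ?r * x) * t)) * of_real (exp (- (0 + ?r * x)\<^sup>2 / (2 * s))))
      (complex_of_real (?r * (sqrt (2 * pi) * exp (- (t * ?r)\<^sup>2 / 2))) /\<^sub>R \<bar>?r\<bar>)"
      unfolding 1 2 by (rule std)
  qed (use s in simp)
  moreover have "?r * (sqrt (2 * pi) * exp (- (t * ?r)\<^sup>2 / 2)) = sqrt (2 * pi * s) * exp (- s * t\<^sup>2 / 2)"
    using s by (simp add: real_sqrt_mult power_mult_distrib mult_ac)
  ultimately show ?thesis by (simp only:)
qed

lemma gaussian_0_prod:
  "exp (\<i> * of_real (x \<bullet> \<xi>)) * gaussian 0 s x
    = (\<Prod>i\<in>UNIV. exp (\<i> * of_real (x $ i * \<xi> $ i)) * of_real (exp (- (x $ i)\<^sup>2 / (2 * s))))"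
proof -
  have "(norm x)\<^sup>2 = (\<Sum>i\<in>UNIV. (x $ i)\<^sup>2)"
    by (simp add: norm_vec_def L2_set_def sum_nonneg)
  then show ?thesis
    by (simp add: gaussian_def prod.distrib exp_sum[symmetric] inner_vec_def sum_distrib_left
        sum_divide_distrib sum_negf flip: of_real_prod)
qed

lemma integral_gaussian_character:
  fixes \<xi> :: "real^'n::finite"
  assumes s: "s > 0"
  shows "(LINT x|lborel. exp (\<i> * of_real (x \<bullet> \<xi>)) * gaussian 0 s x)
       = of_real (sqrt (2 * pi * s) ^ CARD('n)) * of_real (exp (- s * (norm \<xi>)\<^sup>2 / 2))"
proof -
  note h = has_bochner_integral_gaussian_character_1[OF s, unfolded has_bochner_integral_iff]
  have "(LINT x|lborel. exp (\<i> * of_real (x \<bullet> \<xi>)) * gaussian 0 s x)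
     = (\<Prod>i\<in>UNIV. LINT t|lborel. exp (\<i> * of_real (t * \<xi> $ i)) * of_real (exp (- t\<^sup>2 / (2 * s))))"
    unfolding gaussian_0_prod by (rule integral_prod_cart) (use h in blast)
  also have "\<dots> = (\<Prod>i\<in>UNIV. of_real (sqrt (2 * pi * s) * exp (- s * (\<xi> $ i)\<^sup>2 / 2)))"
    using h by (intro prod.cong) blast+
  also have "\<dots> = of_real (sqrt (2 * pi * s) ^ CARD('n)) * of_real (exp (\<Sum>i\<in>UNIV. - s * (\<xi> $ i)\<^sup>2 / 2))"
    by (simp add: prod.distrib exp_sum flip: of_real_prod)
  also have "(\<Sum>i\<in>UNIV. - s * (\<xi> $ i)\<^sup>2 / 2) = - s * (norm \<xi>)\<^sup>2 / 2"
    by (simp add: norm_vec_def L2_set_def sum_nonneg sum_distrib_left sum_divide_distrib)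
  finally show "(LINT x|lborel. exp (\<i> * of_real (x \<bullet> \<xi>)) * gaussian 0 s x)
       = of_real (sqrt (2 * pi * s) ^ CARD('n)) * of_real (exp (- s * (norm \<xi>)\<^sup>2 / 2))" .
qed

lemma fourier_const_pos: "fourier_const TYPE('n::finite) > 0"
  by (simp add: fourier_const_def)

lemma fourier_const_sqrt: "fourier_const TYPE('n::finite) * sqrt (2 * pi) ^ CARD('n) = 1"
proof -
  have "sqrt (2 * pi) ^ CARD('n) = (2 * pi) powr (real CARD('n) / 2)"
    by (simp add: powr_half_sqrt[symmetric] powr_powr powr_realpow[symmetric])
  then show ?thesis by (simp add: fourier_const_def powr_add[symmetric])
qed

section \<open>The inverse transform of integrable functions\<close>

definition inv_fourier :: "(real^'n::finite \<Rightarrow> complex) \<Rightarrow> real^'n \<Rightarrow> complex" where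
  "inv_fourier h x = of_real (fourier_const TYPE('n)) * (LINT \<xi>|lborel. h \<xi> * exp (\<i> * of_real (x \<bullet> \<xi>)))"

lemma integral_lborel_affine:
  fixes f :: "'a::euclidean_space \<Rightarrow> 'b::{banach, second_countable_topology}"
  assumes [measurable]: "f \<in> borel_measurable borel" and c: "c \<noteq> 0"
  shows "(LINT x|lborel. f x) = \<bar>c\<bar> ^ DIM('a) *\<^sub>R (LINT x|lborel. f (t + c *\<^sub>R x))"
    and "integrable lborel (\<lambda>x. f (t + c *\<^sub>R x)) \<longleftrightarrow> integrable lborel f"
proof -
  let ?D = "density (distr lborel borel (\<lambda>x::'a. t + c *\<^sub>R x)) (\<lambda>_. \<bar>c\<bar> ^ DIM('a))"
  have D: "lborel = ?D" by (rule lborel_affine[OF c])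
  have "(LINT x|lborel. f x) = (LINT x|?D. f x)" by (simp only: D[symmetric])
  also have "\<dots> = \<bar>c\<bar> ^ DIM('a) *\<^sub>R (LINT x|lborel. f (t + c *\<^sub>R x))"
    by (subst integral_density) (simp_all add: integral_distr)
  finally show "(LINT x|lborel. f x) = \<bar>c\<bar> ^ DIM('a) *\<^sub>R (LINT x|lborel. f (t + c *\<^sub>R x))" .
  have "integrable lborel f \<longleftrightarrow> integrable ?D f" by (simp only: D[symmetric])
  also have "\<dots> \<longleftrightarrow> integrable lborel (\<lambda>x. f (t + c *\<^sub>R x))"
    using c integrable_scaleR_right[of "\<bar>c\<bar> ^ DIM('a)" lborel "\<lambda>x. f (t + c *\<^sub>R x)"]
      integrable_scaleR_right[of "inverse (\<bar>c\<bar> ^ DIM('a))" lborel "\<lambda>x. \<bar>c\<bar> ^ DIM('a) *\<^sub>R f (t + c *\<^sub>R x)"]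
    by (subst integrable_density) (auto simp: integrable_distr_eq)
  finally show "integrable lborel (\<lambda>x. f (t + c *\<^sub>R x)) \<longleftrightarrow> integrable lborel f" by simp
qed

lemma exp_i_measurable [measurable]:
  assumes [measurable]: "f \<in> borel_measurable M"
  shows "(\<lambda>x. exp (\<i> * complex_of_real (f x))) \<in> borel_measurable M"
proof -
  have "(\<lambda>t. exp (\<i> * complex_of_real t)) \<in> borel_measurable borel"
    by (intro borel_measurable_continuous_onI continuous_intros)
  from measurable_compose[OF assms this] show ?thesis .
qed

lemma integrable_mult_character:
  fixes h :: "'a::euclidean_space \<Rightarrow> complex"
  assumes "integrable lborel h"
  shows "integrable lborel (\<lambda>\<xi>. h \<xi> * exp (\<i> * of_real (x \<bullet> \<xi>)))"
proof -
  have [measurable]: "h \<in> borel_measurable borel" using assms by (auto dest: borel_measurable_integrable)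
  show ?thesis
    by (rule Bochner_Integration.integrable_bound[OF assms]) (auto simp: norm_mult)
qed

lemma inv_fourier_add:
  assumes "integrable lborel f" "integrable lborel g"
  shows "inv_fourier (\<lambda>\<xi>. f \<xi> + g \<xi>) x = inv_fourier f x + inv_fourier g x"
  unfolding inv_fourier_def using integrable_mult_character[OF assms(1), of x] integrable_mult_character[OF assms(2), of x]
  by (simp add: distrib_left distrib_right)

lemma inv_fourier_star:
  fixes h :: "real^'n::finite \<Rightarrow> complex"
  assumes "h \<in> borel_measurable borel"
  shows "inv_fourier (star h) x = cnj (inv_fourier h x)"
proof -
  have [measurable]: "h \<in> borel_measurable borel" by (rule assms)
  have [measurable]: "cnj \<in> borel_measurable borel"
    by (intro borel_measurable_continuous_onI continuous_intros)
  have [measurable]: "star h \<in> borel_measurable borel"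
    unfolding star_def[abs_def] by measurable
  have "(LINT \<xi>|lborel. star h \<xi> * exp (\<i> * of_real (x \<bullet> \<xi>)))
      = (LINT \<xi>|lborel. cnj (h \<xi> * exp (\<i> * of_real (x \<bullet> \<xi>))))"
    by (subst integral_lborel_affine[where c="-1" and t=0]) (auto simp: star_def exp_cnj)
  also have "\<dots> = cnj (LINT \<xi>|lborel. h \<xi> * exp (\<i> * of_real (x \<bullet> \<xi>)))"
    by (rule Bochner_Integration.integral_cnj)
  finally show ?thesis by (simp add: inv_fourier_def)
qed

lemma inv_fourier_cont:
  assumes h: "integrable lborel h"
  shows "continuous_on UNIV (inv_fourier h)"
proof -
  have [measurable]: "h \<in> borel_measurable borel" using h by (auto dest: borel_measurable_integrable)
  have "isCont (inv_fourier h) x" for x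
  proof (rule continuous_at_sequentiallyI)
    fix u assume u: "u \<longlonglongrightarrow> x"
    have "(\<lambda>n. LINT \<xi>|lborel. h \<xi> * exp (\<i> * of_real (u n \<bullet> \<xi>))) \<longlonglongrightarrow> (LINT \<xi>|lborel. h \<xi> * exp (\<i> * of_real (x \<bullet> \<xi>)))"
    proof (rule integral_dominated_convergence[where w="\<lambda>\<xi>. norm (h \<xi>)"])
      show "AE \<xi> in lborel. (\<lambda>n. h \<xi> * exp (\<i> * of_real (u n \<bullet> \<xi>))) \<longlonglongrightarrow> h \<xi> * exp (\<i> * of_real (x \<bullet> \<xi>))"
        by (intro AE_I2 tendsto_intros u)
    qed (auto simp: norm_mult h)
    then show "(\<lambda>n. inv_fourier h (u n)) \<longlonglongrightarrow> inv_fourier h x"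
      unfolding inv_fourier_def by (intro tendsto_intros)
  qed
  then show ?thesis by (simp add: continuous_on_eq_continuous_at)
qed

lemma integrable_product_lborel:
  fixes f :: "'a::euclidean_space \<Rightarrow> complex" and g :: "'b::euclidean_space \<Rightarrow> complex"
  assumes f: "integrable lborel f" and g: "integrable lborel g"
  shows "integrable (lborel \<Otimes>\<^sub>M lborel) (\<lambda>(x, y). f x * g y)"
proof -
  have [measurable]: "f \<in> borel_measurable borel" "g \<in> borel_measurable borel"
    using assms by (auto dest: borel_measurable_integrable)
  show ?thesis
  proof (rule lborel_pair.Fubini_integrable)
    show "integrable lborel (\<lambda>x. LINT y|lborel. norm (case (x, y) of (x, y) \<Rightarrow> f x * g y))"
      using f by (simp add: norm_mult)
    show "AE x in lborel. integrable lborel (\<lambda>y. case (x, y) of (x, y) \<Rightarrow> f x * g y)"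
      using g by simp
  qed measurable
qed

lemma Fubini_mult_bounded:
  fixes f :: "'a::euclidean_space \<Rightarrow> complex" and g :: "'b::euclidean_space \<Rightarrow> complex"
  assumes f: "integrable lborel f" and g: "integrable lborel g"
    and e[measurable]: "(\<lambda>(x, y). e x y) \<in> borel_measurable (borel \<Otimes>\<^sub>M borel)" and b: "\<And>x y. norm (e x y) \<le> 1"
  shows "(LINT x|lborel. (LINT y|lborel. f x * g y * e x y)) = (LINT y|lborel. (LINT x|lborel. f x * g y * e x y))"
proof -
  have [measurable]: "f \<in> borel_measurable borel" "g \<in> borel_measurable borel"
    using assms by (auto dest: borel_measurable_integrable)
  have "integrable (lborel \<Otimes>\<^sub>M lborel) (\<lambda>(x, y). f x * g y * e x y)"
    by (rule Bochner_Integration.integrable_bound[OF integrable_product_lborel[OF f g]])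
       (use b in \<open>auto simp: norm_mult mult_left_le\<close>)
  from lborel_pair.Fubini_integral[OF this] show ?thesis by simp
qed

text \<open>Translating the outer variable by \<open>y\<close> makes the double integral factor. The
  constant inside \<open>convolution\<close> supplies the second copy of
  \<open>fourier_const\<close> that the product on the right contains.\<close>

lemma inv_fourier_convolution:
  fixes f g :: "real^'n::finite \<Rightarrow> complex"
  assumes f: "integrable lborel f" and g: "integrable lborel g"
  shows "inv_fourier (convolution f g) x = inv_fourier f x * inv_fourier g x"
proof -
  let ?c = "complex_of_real (fourier_const TYPE('n))"
  let ?e = "\<lambda>\<xi>. exp (\<i> * complex_of_real (x \<bullet> \<xi>))"
  have [measurable]: "f \<in> borel_measurable borel" "g \<in> borel_measurable borel"
    using assms by (auto dest: borel_measurable_integrable)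
  have shift: "(LINT x|lborel. h (x - y)) = (LINT x|lborel. h x)"
    if "h \<in> borel_measurable borel" for y and h :: "real^'n \<Rightarrow> complex"
    using integral_lborel_affine(1)[OF that, of 1 "- y"] by simp
  have shift_int: "integrable lborel (\<lambda>x. f (x - y))" for y
    using integral_lborel_affine(2)[of f 1 "- y"] f by simp
  have int: "integrable (lborel \<Otimes>\<^sub>M lborel) (\<lambda>(y, \<xi>). f (\<xi> - y) * g y * ?e \<xi>)"
  proof (rule lborel_pair.Fubini_integrable)
    have "integrable lborel (\<lambda>y. norm (g y) * (LINT \<xi>|lborel. norm (f \<xi>)))" using g by simp
    moreover have "(LINT \<xi>|lborel. norm (f (\<xi> - y))) = (LINT \<xi>|lborel. norm (f \<xi>))" for y
      using integral_lborel_affine(1)[of "\<lambda>\<xi>. norm (f \<xi>)" 1 "- y"] by simp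
    ultimately show "integrable lborel (\<lambda>y. LINT \<xi>|lborel. norm (case (y, \<xi>) of (y, \<xi>) \<Rightarrow> f (\<xi> - y) * g y * ?e \<xi>))"
      by (simp add: norm_mult mult.commute)
    show "AE y in lborel. integrable lborel (\<lambda>\<xi>. case (y, \<xi>) of (y, \<xi>) \<Rightarrow> f (\<xi> - y) * g y * ?e \<xi>)"
      using shift_int by (intro AE_I2) (auto intro!: integrable_mult_character)
  qed measurable
  have "inv_fourier (convolution f g) x = ?c * ?c * (LINT \<xi>|lborel. (LINT y|lborel. f (\<xi> - y) * g y * ?e \<xi>))"
  proof -
    have "(LINT y|lborel. f (\<xi> - y) * g y * ?e \<xi>) = (LINT y|lborel. f (\<xi> - y) * g y) * ?e \<xi>" for \<xi>
      by (rule integral_mult_left_zero)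
    then show ?thesis by (simp add: inv_fourier_def convolution_def mult.assoc)
  qed
  also have "(LINT \<xi>|lborel. (LINT y|lborel. f (\<xi> - y) * g y * ?e \<xi>))
      = (LINT y|lborel. (LINT \<xi>|lborel. f (\<xi> - y) * g y * ?e \<xi>))"
    using lborel_pair.Fubini_integral[OF int] by simp
  also have "\<dots> = (LINT y|lborel. (LINT \<xi>|lborel. f \<xi> * ?e \<xi>) * (g y * ?e y))"
  proof (rule Bochner_Integration.integral_cong[OF refl])
    fix y
    have "(LINT \<xi>|lborel. f (\<xi> - y) * g y * ?e \<xi>) = (LINT \<xi>|lborel. (\<lambda>\<eta>. f \<eta> * ?e \<eta> * (g y * ?e y)) (\<xi> - y))"
      by (rule Bochner_Integration.integral_cong[OF refl])
         (simp add: inner_diff_right right_diff_distrib exp_diff)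
    also have "\<dots> = (LINT \<eta>|lborel. f \<eta> * ?e \<eta> * (g y * ?e y))" by (rule shift) measurable
    finally show "(LINT \<xi>|lborel. f (\<xi> - y) * g y * ?e \<xi>) = (LINT \<xi>|lborel. f \<xi> * ?e \<xi>) * (g y * ?e y)" by simp
  qed
  also have "?c * ?c * \<dots> = inv_fourier f x * inv_fourier g x"
    by (simp add: inv_fourier_def)
  finally show ?thesis .
qed

text \<open>A multiplication formula, obtained by interchanging integrals. Through it condition (c)
  on Gaussians becomes a convolution identity for \<open>U\<close>: one factor is written as
  \<open>fourier (U f)\<close>, the other stays as \<open>T g\<close>.\<close>

lemma inv_fourier_mult_fourier:
  fixes f g :: "real^'n::finite \<Rightarrow> complex"
  assumes f: "integrable lborel f" and g: "integrable lborel g"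
  shows "inv_fourier (\<lambda>\<xi>. fourier f \<xi> * g \<xi>) x = of_real (fourier_const TYPE('n)) * (LINT y|lborel. f y * inv_fourier g (x - y))"
proof -
  let ?c = "complex_of_real (fourier_const TYPE('n))"
  have e: "exp (- \<i> * of_real (y \<bullet> \<xi>)) * exp (\<i> * of_real (x \<bullet> \<xi>)) = exp (\<i> * of_real ((x - y) \<bullet> \<xi>))" for y \<xi> :: "real^'n"
    by (simp add: inner_diff_left right_diff_distrib exp_diff exp_minus field_simps)
  have "inv_fourier (\<lambda>\<xi>. fourier f \<xi> * g \<xi>) x
      = ?c * ?c * (LINT \<xi>|lborel. (LINT y|lborel. g \<xi> * f y * exp (\<i> * of_real ((x - y) \<bullet> \<xi>))))"
    unfolding inv_fourier_def fourier_def e[symmetric]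
    by (simp add: mult_ac flip: integral_mult_right_zero integral_mult_left_zero)
  also have "\<dots> = ?c * ?c * (LINT y|lborel. (LINT \<xi>|lborel. g \<xi> * f y * exp (\<i> * of_real ((x - y) \<bullet> \<xi>))))"
    by (subst Fubini_mult_bounded[OF g f]) auto
  also have "\<dots> = ?c * (LINT y|lborel. f y * inv_fourier g (x - y))"
    unfolding inv_fourier_def
    by (simp add: mult_ac flip: integral_mult_right_zero integral_mult_left_zero)
  finally show ?thesis .
qed


section \<open>Gaussian summation and Fourier inversion\<close>

lemma gaussian_integrable: "s > 0 \<Longrightarrow> integrable lborel (gaussian p s)"
  by (intro schwartz_integrable gaussian_schwartz)

text \<open>\<open>inv_fourier h\<close> may fail to be integrable; the damping factor makes the
  double integral absolutely convergent. After the interchange the inner integral is again a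
  Gaussian, of variance \<open>1 / s\<close>, so weak damping averages \<open>h\<close> over a small
  neighbourhood of \<xi>.\<close>

lemma inv_fourier_damped:
  fixes h :: "real^'n::finite \<Rightarrow> complex"
  assumes h: "integrable lborel h" and s: "s > 0"
  shows "(LINT x|lborel. inv_fourier h x * exp (- \<i> * of_real (x \<bullet> \<xi>)) * gaussian 0 s x)
    = (LINT u|lborel. h (\<xi> + (1 / sqrt s) *\<^sub>R u) * gaussian 0 1 u)"
proof -
  let ?c = "complex_of_real (fourier_const TYPE('n))"
  have [measurable]: "h \<in> borel_measurable borel" using h by (auto dest: borel_measurable_integrable)
  have [measurable]: "gaussian 0 1 \<in> borel_measurable (borel :: (real^'n) measure)"
    "gaussian 0 (1 / s) \<in> borel_measurable (borel :: (real^'n) measure)"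
    by (intro borel_measurable_continuous_onI gaussian_cont)+
  have e: "exp (\<i> * of_real (x \<bullet> \<eta>)) * exp (- \<i> * of_real (x \<bullet> \<xi>)) = exp (\<i> * of_real (x \<bullet> (\<eta> - \<xi>)))" for x \<eta> :: "real^'n"
    by (simp add: inner_diff_right right_diff_distrib exp_diff exp_minus field_simps)
  have "(LINT x|lborel. inv_fourier h x * exp (- \<i> * of_real (x \<bullet> \<xi>)) * gaussian 0 s x)
      = (LINT x|lborel. ?c * (LINT \<eta>|lborel. gaussian 0 s x * h \<eta> * exp (\<i> * of_real (x \<bullet> (\<eta> - \<xi>)))))"
    unfolding inv_fourier_def e[symmetric]
    by (simp add: mult_ac flip: integral_mult_right_zero integral_mult_left_zero)
  also have "\<dots> = ?c * (LINT x|lborel. (LINT \<eta>|lborel. gaussian 0 s x * h \<eta> * exp (\<i> * of_real (x \<bullet> (\<eta> - \<xi>)))))"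
    by simp
  also have "\<dots> = ?c * (LINT \<eta>|lborel. (LINT x|lborel. gaussian 0 s x * h \<eta> * exp (\<i> * of_real (x \<bullet> (\<eta> - \<xi>)))))"
    by (subst Fubini_mult_bounded[OF gaussian_integrable[OF s] h]) auto
  also have "\<dots> = ?c * (LINT \<eta>|lborel. h \<eta> * (LINT x|lborel. exp (\<i> * of_real (x \<bullet> (\<eta> - \<xi>))) * gaussian 0 s x))"
    by (simp add: mult_ac flip: integral_mult_right_zero integral_mult_left_zero)
  also have "\<dots> = ?c * (LINT \<eta>|lborel. of_real (sqrt (2 * pi * s) ^ CARD('n)) * (h \<eta> * gaussian 0 (1 / s) (\<eta> - \<xi>)))"
    unfolding integral_gaussian_character[OF s] by (simp add: gaussian_def mult_ac)
  also have "\<dots> = of_real (fourier_const TYPE('n) * sqrt (2 * pi * s) ^ CARD('n)) * (LINT \<eta>|lborel. h \<eta> * gaussian 0 (1 / s) (\<eta> - \<xi>))"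
    by simp
  also have "fourier_const TYPE('n) * sqrt (2 * pi * s) ^ CARD('n) = sqrt s ^ CARD('n)"
    using fourier_const_sqrt[where 'n='n] by (simp add: real_sqrt_mult power_mult_distrib)
  also have "(LINT \<eta>|lborel. h \<eta> * gaussian 0 (1 / s) (\<eta> - \<xi>))
      = (1 / sqrt s) ^ CARD('n) *\<^sub>R (LINT u|lborel. h (\<xi> + (1 / sqrt s) *\<^sub>R u) * gaussian 0 1 u)"
  proof -
    have "gaussian 0 (1 / s) ((1 / sqrt s) *\<^sub>R u) = gaussian 0 1 u" for u :: "real^'n"
      using s by (simp add: gaussian_def power_divide)
    moreover have "\<bar>1 / sqrt s\<bar> = 1 / sqrt s" using s by simp
    ultimately show ?thesis
      using s by (subst integral_lborel_affine(1)[where c = "1 / sqrt s" and t = \<xi>]) simp_all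
  qed
  finally show ?thesis
    using s by (simp add: scaleR_conv_of_real power_divide)
qed

text \<open>An approximate identity at scale \<open>1 / sqrt (Suc n)\<close>; the factor in the
  limit is the total mass of \<open>gaussian 0 1\<close>. The variances \<open>Suc n\<close> are
  positive and increasing, so the damping factors increase to 1, as the monotone convergence below
  requires.\<close>

lemma inv_fourier_damped_tendsto:
  fixes h :: "real^'n::finite \<Rightarrow> complex"
  assumes h: "integrable lborel h" and cont: "continuous_on UNIV h" and b: "\<And>x. norm (h x) \<le> C"
  shows "(\<lambda>n. LINT x|lborel. inv_fourier h x * exp (- \<i> * of_real (x \<bullet> \<xi>)) * gaussian 0 (real (Suc n)) x)
        \<longlonglongrightarrow> of_real (sqrt (2 * pi) ^ CARD('n)) * h \<xi>"
proof -
  have [measurable]: "h \<in> borel_measurable borel" using h by (auto dest: borel_measurable_integrable)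
  have g: "integrable lborel (gaussian 0 1 :: real^'n \<Rightarrow> complex)" by (rule gaussian_integrable) simp
  have [measurable]: "gaussian 0 1 \<in> borel_measurable (borel :: (real^'n) measure)"
    by (intro borel_measurable_continuous_onI gaussian_cont)+
  have "(\<lambda>n. LINT u|lborel. h (\<xi> + (1 / sqrt (real (Suc n))) *\<^sub>R u) * gaussian 0 1 u) \<longlonglongrightarrow> (LINT u|lborel. h \<xi> * gaussian 0 1 (u :: real^'n))"
  proof (rule integral_dominated_convergence[where w="\<lambda>u::real^'n. C * norm (gaussian 0 1 u)"])
    show "AE u in lborel. (\<lambda>n. h (\<xi> + (1 / sqrt (real (Suc n))) *\<^sub>R u) * gaussian 0 1 u) \<longlonglongrightarrow> h \<xi> * gaussian 0 1 u"
    proof (intro AE_I2 tendsto_intros)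
      fix u :: "real^'n"
      have "(\<lambda>n. 1 / sqrt (real (Suc n))) \<longlonglongrightarrow> 0" by real_asymp
      then have "(\<lambda>n. \<xi> + (1 / sqrt (real (Suc n))) *\<^sub>R u) \<longlonglongrightarrow> \<xi> + 0 *\<^sub>R u" by (intro tendsto_intros)
      then show "(\<lambda>n. h (\<xi> + (1 / sqrt (real (Suc n))) *\<^sub>R u)) \<longlonglongrightarrow> h \<xi>"
        using cont by (intro continuous_on_tendsto_compose[OF cont, of _ \<xi>]) auto
    qed
    show "AE u in lborel. norm (h (\<xi> + (1 / sqrt (real (Suc n))) *\<^sub>R u) * gaussian 0 1 u) \<le> C * norm (gaussian 0 1 u)" for n
      by (intro AE_I2) (simp add: norm_mult mult_right_mono b)
  qed (use g in auto)
  moreover have "(LINT u|lborel. gaussian 0 1 (u :: real^'n)) = complex_of_real (sqrt (2 * pi) ^ CARD('n))"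
    using integral_gaussian_character[of 1 "0 :: real^'n"] by simp
  moreover have "(LINT x|lborel. inv_fourier h x * exp (- \<i> * of_real (x \<bullet> \<xi>)) * gaussian 0 (real (Suc n)) x)
      = (LINT u|lborel. h (\<xi> + (1 / sqrt (real (Suc n))) *\<^sub>R u) * gaussian 0 1 u)" for n
    by (rule inv_fourier_damped[OF h]) simp
  ultimately show ?thesis by (simp only: integral_mult_right_zero mult.commute[of _ "h \<xi>"])
qed

text \<open>At frequency 0 the damped integrals of \<open>k\<close> have no oscillating factor. By
  positivity they increase with \<open>n\<close>, and their limit is the finite number given by
  \<open>h 0\<close>, so monotone convergence applies.\<close>

lemma inv_fourier_nonneg_integrable:
  fixes h :: "real^'n::finite \<Rightarrow> complex"
  assumes h: "integrable lborel h" and cont: "continuous_on UNIV h" and b: "\<And>x. norm (h x) \<le> C"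
    and k: "\<And>x. inv_fourier h x = of_real (k x)" "\<And>x. k x \<ge> 0"
  shows "integrable lborel (inv_fourier h)"
proof -
  have kc: "continuous_on UNIV k"
    using continuous_on_Re[OF inv_fourier_cont[OF h]] by (simp add: k(1))
  then have [measurable]: "k \<in> borel_measurable borel" by (rule borel_measurable_continuous_onI)
  define g where "g n x = exp (- (norm x)\<^sup>2 / (2 * real (Suc n)))" for n and x :: "real^'n"
  have g: "gaussian 0 (real (Suc n)) x = of_real (g n x)" for n x by (simp add: gaussian_def g_def)
  have [measurable]: "g n \<in> borel_measurable borel" for n
    unfolding g_def[abs_def] by measurable
  have gi: "integrable lborel (g n)" for n
    using integrable_Re[OF gaussian_integrable[of "real (Suc n)" "0 :: real^'n"]] by (simp add: g del: of_nat_Suc)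
  have kb: "k x \<le> fourier_const TYPE('n) * (LINT \<xi>|lborel. norm (h \<xi>))" for x
  proof -
    have "k x = norm (inv_fourier h x)" using k by simp
    also have "\<dots> \<le> fourier_const TYPE('n) * (LINT \<xi>|lborel. norm (h \<xi> * exp (\<i> * of_real (x \<bullet> \<xi>))))"
      unfolding inv_fourier_def norm_mult[of "of_real _"] using fourier_const_pos[where 'n='n]
      by (simp only: norm_of_real abs_of_pos) (intro mult_left_mono integral_norm_bound, simp)
    finally show ?thesis by (simp add: norm_mult)
  qed
  have kgi: "integrable lborel (\<lambda>x. k x * g n x)" for n
    by (rule Bochner_Integration.integrable_bound[OF integrable_mult_right[OF gi, of "fourier_const TYPE('n) * (LINT \<xi>|lborel. norm (h \<xi>))" n]])
       (use k(2) kb in \<open>auto simp: abs_mult g_def intro!: mult_right_mono abs_leI order_trans[OF kb]\<close>)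
  have "(\<lambda>n. of_real (LINT x|lborel. k x * g n x)) \<longlonglongrightarrow> complex_of_real (sqrt (2 * pi) ^ CARD('n)) * h 0"
    using inv_fourier_damped_tendsto[OF h cont b, of 0] by (simp add: k(1) g del: of_nat_Suc flip: of_real_mult)
  from tendsto_Re[OF this]
  have lim: "(\<lambda>n. LINT x|lborel. k x * g n x) \<longlonglongrightarrow> Re (complex_of_real (sqrt (2 * pi) ^ CARD('n)) * h 0)" by simp
  have "integrable lborel k"
  proof (rule integrable_monotone_convergence(1)[OF kgi _ _ lim])
    show "AE x in lborel. mono (\<lambda>n. k x * g n x)"
      by (intro AE_I2 monoI mult_left_mono k(2)) (auto simp: g_def intro!: divide_left_mono)
    have "(\<lambda>n. g n x) \<longlonglongrightarrow> 1" for x unfolding g_def by real_asymp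
    then show "AE x in lborel. (\<lambda>n. k x * g n x) \<longlonglongrightarrow> k x"
      by (intro AE_I2) (auto intro!: tendsto_eq_intros)
  qed measurable
  then show ?thesis by (simp add: k(1)[abs_def] integrable_of_real)
qed

text \<open>Integrability of \<open>inv_fourier h\<close> allows the damping to be removed by
  dominated convergence; the limit found above must then be the undamped integral. Continuity of
  \<open>h\<close> makes this hold at every point.\<close>

lemma fourier_inv_fourier:
  fixes h :: "real^'n::finite \<Rightarrow> complex"
  assumes h: "integrable lborel h" and cont: "continuous_on UNIV h" and b: "\<And>x. norm (h x) \<le> C"
    and k: "integrable lborel (inv_fourier h)"
  shows "fourier (inv_fourier h) = h"
proof
  fix \<xi>
  have [measurable]: "inv_fourier h \<in> borel_measurable borel" using k by (auto dest: borel_measurable_integrable)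
  have [measurable]: "gaussian 0 s \<in> borel_measurable (borel :: (real^'n) measure)" for s
    by (intro borel_measurable_continuous_onI gaussian_cont)+
  let ?f = "\<lambda>x. inv_fourier h x * exp (- \<i> * of_real (x \<bullet> \<xi>))"
  have [measurable]: "?f \<in> borel_measurable borel"
    using exp_i_measurable[of "\<lambda>x. - (x \<bullet> \<xi>)" borel] by simp
  have "(\<lambda>n. LINT x|lborel. ?f x * gaussian 0 (real (Suc n)) x) \<longlonglongrightarrow> (LINT x|lborel. ?f x * 1)"
  proof (rule integral_dominated_convergence[where w="\<lambda>x. norm (inv_fourier h x)"])
    have "(\<lambda>n. exp (- (norm x)\<^sup>2 / (2 * real (Suc n)))) \<longlonglongrightarrow> 1" for x :: "real^'n" by real_asymp
    from tendsto_of_real[OF this]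
    have "(\<lambda>n. gaussian 0 (real (Suc n)) x) \<longlonglongrightarrow> 1" for x :: "real^'n" by (simp add: gaussian_def)
    then show "AE x in lborel. (\<lambda>n. ?f x * gaussian 0 (real (Suc n)) x) \<longlonglongrightarrow> ?f x * 1"
      by (intro AE_I2 tendsto_intros)
    show "AE x in lborel. norm (?f x * gaussian 0 (real (Suc n)) x) \<le> norm (inv_fourier h x)" for n
      by (intro AE_I2) (simp add: norm_mult gaussian_def mult_left_le)
  qed (use k in auto)
  from LIMSEQ_unique[OF this inv_fourier_damped_tendsto[OF h cont b]]
  have "(LINT x|lborel. ?f x) = of_real (sqrt (2 * pi) ^ CARD('n)) * h \<xi>" by simp
  then have "fourier (inv_fourier h) \<xi> = of_real (fourier_const TYPE('n) * sqrt (2 * pi) ^ CARD('n)) * h \<xi>"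
    by (simp add: fourier_def)
  then show "fourier (inv_fourier h) \<xi> = h \<xi>" by (simp only: fourier_const_sqrt) simp
qed

text \<open>Supplies a function whose inverse transform vanishes nowhere, which shows that none of
  the characters \<open>U f x\<close> is trivial.\<close>

lemma inv_fourier_gaussian: "inv_fourier (gaussian 0 1) x = gaussian 0 1 x"
proof -
  have "inv_fourier (gaussian 0 1) x = of_real (fourier_const TYPE('a) * sqrt (2 * pi) ^ CARD('a)) * gaussian 0 1 x"
    using integral_gaussian_character[of 1 x]
    by (simp add: inv_fourier_def gaussian_def mult_ac inner_commute)
  then show ?thesis by (simp only: fourier_const_sqrt) simp
qed

section \<open>Determination of the transform\<close>

lemma convolution_gaussian:
  fixes p q :: "real^'n::finite"
  assumes s: "s > 0"
  shows "convolution (gaussian p s) (gaussian q s) = (\<lambda>x. of_real (sqrt (s / 2) ^ CARD('n)) * gaussian (p + q) (2 * s) x)"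
proof
  fix x :: "real^'n"
  \<comment> \<open>As functions of \<open>y\<close> the two factors are centred at
    \<open>x - p\<close> and \<open>q\<close>, and \<open>m\<close> is the midpoint. Completing the
    square about it is the parallelogram law for \<open>x - y - p\<close> and
    \<open>y - q\<close>.\<close>
  define m where "m = (1 / 2) *\<^sub>R (x - p + q)"
  have [measurable]: "gaussian m (s / 2) \<in> borel_measurable borel"
    by (intro borel_measurable_continuous_onI gaussian_cont)
  have arith: "- a / (2 * s) + - b / (2 * s) = - c / (2 * (2 * s)) + - d / (2 * (s / 2))"
    if "a + b = c / 2 + 2 * d" for a b c d
  proof -
    have "- a / (2 * s) + - b / (2 * s) = - (a + b) / (2 * s)" by (simp add: diff_divide_distrib)
    also have "\<dots> = - c / (2 * (2 * s)) + - d / (2 * (s / 2))"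
      unfolding that using s by (simp add: field_simps)
    finally show ?thesis .
  qed
  have "gaussian p s (x - y) * gaussian q s y = gaussian (p + q) (2 * s) x * gaussian m (s / 2) y" for y
  proof -
    have "(norm (x - y - p))\<^sup>2 + (norm (y - q))\<^sup>2 = (norm (x - (p + q)))\<^sup>2 / 2 + 2 * (norm (y - m))\<^sup>2"
      unfolding power2_norm_eq_inner m_def
      by (simp add: inner_add_left inner_add_right inner_diff_left inner_diff_right inner_commute algebra_simps)
        (simp add: field_simps)
    then have "- (norm (x - y - p))\<^sup>2 / (2 * s) + - (norm (y - q))\<^sup>2 / (2 * s)
        = - (norm (x - (p + q)))\<^sup>2 / (2 * (2 * s)) + - (norm (y - m))\<^sup>2 / (2 * (s / 2))"
      by (rule arith)
    then show ?thesis unfolding gaussian_def of_real_mult[symmetric] exp_add[symmetric] by simp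
  qed
  then have "convolution (gaussian p s) (gaussian q s) x
      = of_real (fourier_const TYPE('n)) * (gaussian (p + q) (2 * s) x * (LINT y|lborel. gaussian m (s / 2) y))"
    by (simp add: convolution_def)
  also have "(LINT y|lborel. gaussian m (s / 2) y) = (LINT y|lborel. gaussian 0 (s / 2) (y :: real^'n))"
  proof -
    have "gaussian m (s / 2) (m + u) = gaussian 0 (s / 2) u" for u by (simp add: gaussian_def)
    then show ?thesis by (subst integral_lborel_affine(1)[where c=1 and t=m]) simp_all
  qed
  also have "\<dots> = of_real (sqrt (2 * pi * (s / 2)) ^ CARD('n))"
    using integral_gaussian_character[of "s / 2" "0 :: real^'n"] s by simp
  also have "sqrt (2 * pi * (s / 2)) ^ CARD('n) = sqrt (2 * pi) ^ CARD('n) * sqrt (s / 2) ^ CARD('n)"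
    by (simp only: real_sqrt_mult power_mult_distrib)
  also have "of_real (fourier_const TYPE('n)) * (gaussian (p + q) (2 * s) x * of_real (sqrt (2 * pi) ^ CARD('n) * sqrt (s / 2) ^ CARD('n)))
      = of_real ((fourier_const TYPE('n) * sqrt (2 * pi) ^ CARD('n)) * sqrt (s / 2) ^ CARD('n)) * gaussian (p + q) (2 * s) x"
    by (simp only: of_real_mult mult_ac)
  finally show "convolution (gaussian p s) (gaussian q s) x = of_real (sqrt (s / 2) ^ CARD('n)) * gaussian (p + q) (2 * s) x"
    by (simp only: fourier_const_sqrt mult_1)
qed

text \<open>If \<open>\<phi> (x + y)\<close> differed from \<open>\<phi> x + \<phi> y\<close>, the right-hand side of the convolution identity,
  with centres \<open>\<phi> x\<close> and \<open>\<phi> y\<close>, would decay more slowly than the left-hand side as \<open>s\<close> tends to \<open>0\<close>.\<close>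

lemma additive_of_gaussian_convolution:
  fixes \<phi> :: "real^'n::finite \<Rightarrow> real^'n"
  assumes cont: "continuous_on UNIV \<phi>"
    and int: "\<And>p s. s > 0 \<Longrightarrow> integrable lborel (\<lambda>y. gaussian p s (\<phi> y))"
    and conv: "\<And>p q s x. s > 0 \<Longrightarrow> of_real (sqrt (s / 2) ^ CARD('n)) * gaussian (p + q) (2 * s) (\<phi> x)
        = convolution (\<lambda>y. gaussian p s (\<phi> y)) (\<lambda>y. gaussian q s (\<phi> y)) x"
  shows "\<phi> (x + y) = \<phi> x + \<phi> y"
proof (rule ccontr)
  assume neq: "\<phi> (x + y) \<noteq> \<phi> x + \<phi> y"
  let ?c = "fourier_const TYPE('n)"
  have c: "?c > 0" by (rule fourier_const_pos)
  define D where "D = (norm (\<phi> (x + y) - (\<phi> x + \<phi> y)))\<^sup>2"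
  have D: "D > 0" using neq by (simp add: D_def)
  \<comment> \<open>The exponent of the convolution integrand at the point \<open>x + y\<close>, for
    the centres \<open>\<phi> x\<close> and \<open>\<phi> y\<close>. It vanishes at
    \<open>z = y\<close>, so there the integrand stays large.\<close>
  define F where "F z = (norm (\<phi> (x + y - z) - \<phi> x))\<^sup>2 + (norm (\<phi> z - \<phi> y))\<^sup>2" for z
  have cont': "continuous_on UNIV (\<lambda>z. \<phi> (x + y - z))"
    by (intro continuous_on_compose2[OF cont] continuous_intros) auto
  have F_cont: "continuous_on UNIV F"
    unfolding F_def[abs_def] by (intro continuous_intros cont cont')
  then have [measurable]: "F \<in> borel_measurable borel" by (rule borel_measurable_continuous_onI)
  have "F y = 0" by (simp add: F_def)
  \<comment> \<open>With the threshold \<open>D / 4\<close> the integrand is at least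
    \<open>exp (- D / (8 * s))\<close> on the ball, while the left-hand side carries the square of
    this number. Cancelling one factor leaves a fixed positive number below a quantity that tends to
    0 with \<open>s\<close>.\<close>
  then obtain \<delta> where \<delta>: "\<delta> > 0" "\<And>z. dist z y < \<delta> \<Longrightarrow> F z < D / 4"
    using F_cont D unfolding continuous_on_iff by (metis UNIV_I abs_less_iff diff_zero dist_real_def zero_less_divide_iff zero_less_numeral)
  define v where "v = measure lborel (ball y \<delta>)"
  have v: "v > 0" unfolding v_def using \<delta>(1) by (simp add: content_ball_pos)
  \<comment> \<open>The bound \<open>s \<le> 2\<close> makes the prefactor at most 1, and
    \<open>exp t \<ge> t\<close> at \<open>t = D / (8 * s)\<close> produces the final
    estimate.\<close>
  have le: "?c * v \<le> 8 * s / D" if s: "s > 0" "s \<le> 2" for s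
  proof -
    have G: "gaussian (\<phi> x) s (\<phi> (x + y - z)) * gaussian (\<phi> y) s (\<phi> z) = of_real (exp (- F z / (2 * s)))" for z
      unfolding gaussian_def of_real_mult[symmetric] exp_add[symmetric] F_def by (simp add: add_divide_distrib diff_divide_distrib)
    have int': "integrable lborel (\<lambda>z. exp (- F z / (2 * s)))"
    proof (rule Bochner_Integration.integrable_bound[OF int[OF s(1), of "\<phi> y"]])
      have "- F z / (2 * s) \<le> - (norm (\<phi> z - \<phi> y))\<^sup>2 / (2 * s)" for z
        using s(1) by (intro divide_right_mono) (auto simp: F_def)
      then show "AE z in lborel. norm (exp (- F z / (2 * s))) \<le> norm (gaussian (\<phi> y) s (\<phi> z))"
        by (intro AE_I2) (simp only: gaussian_def norm_of_real real_norm_def abs_exp_cancel exp_le_cancel_iff)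
    qed measurable
    have "of_real (sqrt (s / 2) ^ CARD('n) * exp (- D / (2 * (2 * s))))
        = of_real (sqrt (s / 2) ^ CARD('n)) * gaussian (\<phi> x + \<phi> y) (2 * s) (\<phi> (x + y))"
      by (simp add: gaussian_def D_def)
    also have "\<dots> = complex_of_real ?c * (LINT z|lborel. of_real (exp (- F z / (2 * s))))"
      unfolding conv[OF s(1)] convolution_def G ..
    also have "\<dots> = of_real (?c * (LINT z|lborel. exp (- F z / (2 * s))))"
      by (simp del: of_real_exp)
    finally have eq: "sqrt (s / 2) ^ CARD('n) * exp (- D / (2 * (2 * s))) = ?c * (LINT z|lborel. exp (- F z / (2 * s)))"
      by (simp only: of_real_eq_iff)
    have "v * exp (- D / (8 * s)) = (LINT z|lborel. exp (- D / (8 * s)) * indicator (ball y \<delta>) z)"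
      by (simp add: v_def)
    also have "\<dots> \<le> (LINT z|lborel. exp (- F z / (2 * s)))"
    proof (rule integral_mono[OF _ int'])
      show "integrable lborel (\<lambda>z. exp (- D / (8 * s)) * indicator (ball y \<delta>) z)"
        by (intro integrable_mult_right integrable_real_indicator) (use emeasure_bounded_finite[OF bounded_ball, of y \<delta>] in auto)
      fix z
      show "exp (- D / (8 * s)) * indicator (ball y \<delta>) z \<le> exp (- F z / (2 * s))"
        using \<delta>(2)[of z] s(1) by (auto simp: indicator_def dist_commute field_simps)
    qed
    finally have "?c * v * exp (- D / (8 * s)) \<le> sqrt (s / 2) ^ CARD('n) * exp (- D / (2 * (2 * s)))"
      unfolding eq using c by (simp add: mult.assoc)
    also have "\<dots> \<le> 1 * exp (- D / (2 * (2 * s)))"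
      using s by (intro mult_right_mono power_le_one) auto
    also have "- D / (2 * (2 * s)) = - D / (8 * s) + - D / (8 * s)" using s by (simp add: field_simps)
    finally have "?c * v * exp (- D / (8 * s)) \<le> exp (- D / (8 * s)) * exp (- D / (8 * s))"
      by (simp only: exp_add mult_1)
    then have "?c * v \<le> exp (- D / (8 * s))" by (rule mult_right_le_imp_le) simp
    also have "\<dots> = inverse (exp (D / (8 * s)))" by (simp add: exp_minus)
    also have "\<dots> \<le> inverse (D / (8 * s))"
      using D s by (intro le_imp_inverse_le) (auto intro: order_trans[OF _ exp_ge_add_one_self])
    finally show ?thesis by simp
  qed
  \<comment> \<open>Chosen so that \<open>8 * s / D\<close> is at most half of
    \<open>?c * v\<close>.\<close>
  define s where "s = min 2 (?c * v * D / 16)"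
  have s: "s > 0" "s \<le> 2" using c v D by (auto simp: s_def)
  have "?c * v \<le> 8 * s / D" by (rule le[OF s])
  also have "\<dots> \<le> 8 * (?c * v * D / 16) / D" using D by (intro divide_right_mono mult_left_mono) (auto simp: s_def)
  also have "\<dots> = ?c * v / 2" using D by simp
  finally show False using c v by simp
qed

text \<open>A left inverse of \<open>B\<close> is bounded, so \<open>norm (B *v x)\<close> grows at
  least linearly in \<open>norm x\<close>.\<close>

lemma decaying_compose_linear:
  fixes B :: "real^'n::finite^'n"
  assumes f: "decaying f" and B: "invertible B"
  shows "decaying (\<lambda>x. f (B *v x))"
  unfolding decaying_def
proof
  fix N
  obtain A where A: "A ** B = mat 1" using B by (auto simp: invertible_def)
  obtain K where K: "\<And>y. norm (A *v y) \<le> norm y * K" "K \<ge> 0"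
    using bounded_linear.nonneg_bounded[OF matrix_vector_mul_bounded_linear[of A]] by blast
  obtain C where C: "\<And>x. norm (f x) * (1 + norm x) ^ N \<le> C" using f by (metis decayingE)
  have "norm (f (B *v x)) * (1 + norm x) ^ N \<le> (1 + K) ^ N * C" for x
  proof -
    have "x = A *v (B *v x)" using A by (simp add: matrix_vector_mul_assoc)
    then have "norm x \<le> norm (B *v x) * K" using K(1)[of "B *v x"] by simp
    moreover have "(1 + K) * (1 + norm (B *v x)) = 1 + norm (B *v x) + K + norm (B *v x) * K"
      by (simp add: algebra_simps)
    ultimately have "1 + norm x \<le> (1 + K) * (1 + norm (B *v x))"
      using K(2) norm_ge_zero[of "B *v x"] by linarith
    then have "(1 + norm x) ^ N \<le> ((1 + K) * (1 + norm (B *v x))) ^ N" by (intro power_mono) auto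
    then have "norm (f (B *v x)) * (1 + norm x) ^ N \<le> norm (f (B *v x)) * ((1 + K) * (1 + norm (B *v x))) ^ N"
      by (rule mult_left_mono) simp
    also have "\<dots> = (1 + K) ^ N * (norm (f (B *v x)) * (1 + norm (B *v x)) ^ N)"
      by (simp add: power_mult_distrib)
    also have "\<dots> \<le> (1 + K) ^ N * C" using K(2) by (intro mult_left_mono C) auto
    finally show ?thesis .
  qed
  then show "\<exists>C. \<forall>x. norm (f (B *v x)) * (1 + norm x) ^ N \<le> C" by blast
qed

theorem theorem2p1:
  fixes T :: "(real^'n::finite \<Rightarrow> complex) \<Rightarrow> (real^'n \<Rightarrow> complex)"
  assumes bij: "bij_betw T schwartz schwartz"
    and a: "\<And>f g. f \<in> schwartz \<Longrightarrow> g \<in> schwartz \<Longrightarrow>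
              T (\<lambda>x. f x + cnj (g x)) = (\<lambda>x. T f x + star (T g) x)"
    and b: "\<And>f g. f \<in> schwartz \<Longrightarrow> g \<in> schwartz \<Longrightarrow>
              T (\<lambda>x. f x * g x) = convolution (T f) (T g)"
    and c: "\<And>f g. f \<in> schwartz \<Longrightarrow> g \<in> schwartz \<Longrightarrow>
              T (convolution f g) = (\<lambda>x. T f x * T g x)"
  shows "\<exists>B :: real^'n^'n. invertible B \<and> \<bar>det B\<bar> = 1 \<and>
           ((\<forall>f\<in>schwartz. T f = fourier (\<lambda>x. f (B *v x))) \<or>
            (\<forall>f\<in>schwartz. T f = fourier (\<lambda>x. cnj (f (B *v x)))))"
proof -
  let ?zero = "\<lambda>x::real^'n. 0 :: complex"
  define U where "U f = inv_fourier (T f)" for f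
  have TS: "T f \<in> schwartz" if "f \<in> schwartz" for f using bij that by (auto simp: bij_betw_def)
  have Tint: "integrable lborel (T f)" and Tcont: "continuous_on UNIV (T f)" if "f \<in> schwartz" for f
    using TS[OF that] by (auto intro: schwartz_integrable schwartz_cont)
  have inversion: "T f = fourier (U f)" if f: "f \<in> schwartz" and "integrable lborel (U f)" for f
  proof -
    obtain C where "\<And>x. norm (T f x) \<le> C" using TS[OF f] by (metis schwartz_bounded)
    then show ?thesis using that unfolding U_def by (intro fourier_inv_fourier[symmetric] Tint Tcont)
  qed
  have star0: "star h x = 0 \<longleftrightarrow> h (- x) = 0" for h :: "real^'n \<Rightarrow> complex" and x by (simp add: star_def)
  \<comment> \<open>Condition (a) packs two laws together. Once the zero function is known to be
    fixed, \<open>f = 0\<close> isolates conjugation, and replacing \<open>g\<close> by its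
    conjugate leaves plain additivity.\<close>
  have T0: "T ?zero = ?zero"
  proof
    fix x
    have "T ?zero (- x) = T ?zero (- x) + star (T ?zero) (- x)"
      using fun_cong[OF a[OF schwartz_zero schwartz_zero], of "- x"] by simp
    then show "T ?zero x = 0" by (simp add: star0)
  qed
  have T_cnj: "T (\<lambda>x. cnj (f x)) = star (T f)" if "f \<in> schwartz" for f
    using a[OF schwartz_zero that] by (simp add: T0)
  have T_add: "T (\<lambda>x. f x + g x) = (\<lambda>x. T f x + T g x)" if "f \<in> schwartz" "g \<in> schwartz" for f g
    using a[OF that(1) schwartz_cnj[OF that(2)]] by (simp add: T_cnj that star_def)
  \<comment> \<open>By surjectivity some \<open>g0\<close> has the standard Gaussian as its image.
    Then \<open>U g0\<close> is that Gaussian, so the character at every \<open>x\<close> is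
    nonzero.\<close>
  obtain g0 where g0: "g0 \<in> schwartz" "T g0 = gaussian 0 1"
    using bij gaussian_schwartz[of 1 "0 :: real^'n"] by (force simp: bij_betw_def image_iff)
  have "\<exists>p. (\<forall>f\<in>schwartz. U f x = f p) \<or> (\<forall>f\<in>schwartz. U f x = cnj (f p))" for x
  proof (rule schwartz_character[of "\<lambda>f. U f x"])
    show "U (\<lambda>y. f y + g y) x = U f x + U g x" if "f \<in> schwartz" "g \<in> schwartz" for f g
      unfolding U_def T_add[OF that] by (intro inv_fourier_add Tint that)
    show "U (\<lambda>y. f y * g y) x = U f x * U g x" if "f \<in> schwartz" "g \<in> schwartz" for f g
      unfolding U_def b[OF that] by (intro inv_fourier_convolution Tint that)
    show "U (\<lambda>y. cnj (f y)) x = cnj (U f x)" if "f \<in> schwartz" for f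
      unfolding U_def T_cnj[OF that]
      by (intro inv_fourier_star borel_measurable_continuous_onI Tcont that)
    show "g0 \<in> schwartz" by (rule g0)
    show "U g0 x \<noteq> 0" by (simp add: U_def g0 inv_fourier_gaussian) (simp add: gaussian_def)
  qed
  then obtain \<phi> where \<phi>: "\<And>x. (\<forall>f\<in>schwartz. U f x = f (\<phi> x)) \<or> (\<forall>f\<in>schwartz. U f x = cnj (f (\<phi> x)))"
    by metis
  \<comment> \<open>On real-valued functions the two alternatives coincide, so \<phi> can be studied
    before the choice between them is settled.\<close>
  have U_real: "U f x = f (\<phi> x)" if "f \<in> schwartz" "\<And>y. cnj (f y) = f y" for f x
    using \<phi>[of x] that by auto
  have U_cont: "continuous_on UNIV (U f)" if "f \<in> schwartz" for f
    unfolding U_def by (intro inv_fourier_cont Tint that)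
  have G: "gaussian p s \<in> schwartz" if "s > 0" for p :: "real^'n" and s by (rule gaussian_schwartz[OF that])
  have G_cnj: "cnj (gaussian p s y) = gaussian p s y" for p y :: "real^'n" and s by (simp add: gaussian_def)
  have UG: "U (gaussian p s) = (\<lambda>x. gaussian p s (\<phi> x))" if "s > 0" for p s
    using U_real[OF G[OF that] G_cnj] by blast
  have G_nz: "gaussian 0 1 y \<noteq> 0" for y :: "real^'n" by (simp add: gaussian_def)
  let ?G = "gaussian (0 :: real^'n) 1"
  have \<phi>_cont: "continuous_on UNIV \<phi>"
  proof -
    \<comment> \<open>The coordinates of \<phi> are quotients of values of \<open>U\<close> at
      real-valued functions, with a denominator that never vanishes.\<close>
    have "continuous_on UNIV (\<lambda>x. \<chi> j. Re (U (\<lambda>y. of_real (y $ j) * ?G y) x / U ?G x))"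
      by (intro continuous_on_vec_lambda continuous_intros U_cont schwartz_coord G) (auto simp: UG G_nz)
    moreover have "U (\<lambda>y. of_real (y $ j) * ?G y) x = of_real (\<phi> x $ j) * ?G (\<phi> x)" for j x
      by (rule U_real, intro schwartz_coord G) (simp_all add: G_cnj)
    ultimately show ?thesis by (simp add: UG G_nz)
  qed
  have UG_int: "integrable lborel (U (gaussian p s))" if s: "s > 0" for p s
  proof -
    obtain C where "\<And>x. norm (T (gaussian p s) x) \<le> C" using TS[OF G[OF s]] by (metis schwartz_bounded)
    then show ?thesis
      unfolding U_def
      by (rule inv_fourier_nonneg_integrable[OF Tint[OF G[OF s]] Tcont[OF G[OF s]], where k="\<lambda>x. exp (- (norm (\<phi> x - p))\<^sup>2 / (2 * s))"])
         (use UG[OF s, of p] in \<open>simp_all add: U_def gaussian_def fun_eq_iff\<close>)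
  qed
  have conv: "of_real (sqrt (s / 2) ^ CARD('n)) * gaussian (p + q) (2 * s) (\<phi> x)
        = convolution (\<lambda>y. gaussian p s (\<phi> y)) (\<lambda>y. gaussian q s (\<phi> y)) x" if s: "s > 0" for p q s x
  proof -
    have "of_real (sqrt (s / 2) ^ CARD('n)) * gaussian (p + q) (2 * s) (\<phi> x)
        = U (\<lambda>y. of_real (sqrt (s / 2) ^ CARD('n)) * gaussian (p + q) (2 * s) y) x"
      by (rule U_real[symmetric], intro schwartz_scale G) (use s in \<open>simp_all add: G_cnj\<close>)
    \<comment> \<open>The factors are exchanged because \<open>inv_fourier_mult_fourier\<close>
      gives the shifted argument to the factor left as \<open>T\<close>, while
      \<open>convolution\<close> gives it to the first.\<close>
    also have "\<dots> = U (convolution (gaussian q s) (gaussian p s)) x"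
      unfolding convolution_gaussian[OF s] by (simp add: add.commute)
    also have "\<dots> = inv_fourier (\<lambda>\<xi>. fourier (U (gaussian q s)) \<xi> * T (gaussian p s) \<xi>) x"
      unfolding U_def[of "convolution _ _"] c[OF G[OF s] G[OF s]] inversion[OF G[OF s] UG_int[OF s], symmetric] ..
    also have "\<dots> = of_real (fourier_const TYPE('n)) * (LINT y|lborel. U (gaussian q s) y * U (gaussian p s) (x - y))"
      unfolding U_def[of "gaussian p s"] by (rule inv_fourier_mult_fourier[OF UG_int[OF s] Tint[OF G[OF s]]])
    also have "\<dots> = convolution (\<lambda>y. gaussian p s (\<phi> y)) (\<lambda>y. gaussian q s (\<phi> y)) x"
      by (simp add: convolution_def UG[OF s] mult.commute)
    finally show ?thesis .
  qed
  have add: "\<phi> (x + y) = \<phi> x + \<phi> y" for x y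
    by (rule additive_of_gaussian_convolution[OF \<phi>_cont _ conv]) (use UG_int in \<open>simp_all add: UG\<close>)
  have "linear \<phi>"
    by (rule linearI) (auto simp: add additive_continuous_scaleR[OF add \<phi>_cont])
  define B where "B = matrix \<phi>"
  have B: "\<phi> x = B *v x" for x unfolding B_def by (simp add: matrix_works \<open>linear \<phi>\<close>)

  have inv: "invertible B"
  proof (rule ccontr)
    assume "\<not> invertible B"
    then have "\<not> (\<exists>C. C ** transpose B = mat 1)"
      by (simp add: invertible_det_nz det_transpose flip: invertible_left_inverse)
    then obtain u where u: "transpose B *v u = 0" "u \<noteq> 0"
      using matrix_left_invertible_ker by blast
    have perp: "(B *v x) \<bullet> u = 0" for x
      using u(1) by (simp add: dot_lmul_matrix[symmetric] inner_commute matrix_vector_mul_assoc flip: dot_matrix_vector_mul)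
    \<comment> \<open>If \<open>B\<close> is singular, some \<open>u\<close> is orthogonal to its
      range. This nonzero Schwartz function, the linear form of \<open>u\<close> times a Gaussian,
      vanishes on the range, so \<open>U\<close> sends it to 0 and injectivity of \<open>T\<close>
      fails.\<close>
    define f where "f y = (\<Sum>j\<in>UNIV. of_real (u $ j) * (of_real (y $ j) * ?G y))" for y
    have f: "f \<in> schwartz"
      unfolding f_def[abs_def] by (intro schwartz_sum schwartz_scale schwartz_coord G) auto
    have f_eq: "f y = of_real (y \<bullet> u) * ?G y" for y
      by (simp add: f_def inner_vec_def sum_distrib_left mult_ac)
    have "U f = ?zero"
      using U_real[OF f] by (auto simp: f_eq G_cnj B perp)
    then have "T f = fourier ?zero" using inversion[OF f] by simp
    then have "T f = T ?zero" by (simp add: T0 fourier_def[abs_def])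
    then have "f = ?zero" using bij f schwartz_zero by (auto simp: bij_betw_def inj_on_def)
    then have "f u = 0" by simp
    then show False using u(2) by (simp add: f_eq G_nz)
  qed

  have det: "\<bar>det B\<bar> = 1"
  proof -
    \<comment> \<open>\<open>h\<close> is the integrand when the standard Gaussian is convolved with
      itself at the origin. The same identity after composing with \<phi> has integrand
      \<open>h (B *v y)\<close> and, because \<open>\<phi> 0 = 0\<close>, the same value. So both
      integrals equal \<open>K\<close>.\<close>
    define h :: "real^'n \<Rightarrow> real" where "h y = exp (- (norm y)\<^sup>2)" for y
    have h: "?G (- y) * ?G y = of_real (h y)" for y
      unfolding gaussian_def h_def of_real_mult[symmetric] exp_add[symmetric] by simp
    have [measurable]: "h \<in> borel_measurable borel" unfolding h_def[abs_def] by measurable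
    have h_nonneg: "0 \<le> h y" for y by (simp add: h_def)
    define K where "K = sqrt (1 / 2) ^ CARD('n) / fourier_const TYPE('n)"
    have K: "K > 0" by (simp add: K_def fourier_const_pos)
    have "of_real (sqrt (1 / 2) ^ CARD('n)) = complex_of_real (fourier_const TYPE('n)) * (LINT y|lborel. of_real (h y))"
      using fun_cong[OF convolution_gaussian[of 1 "0::real^'n" 0], of 0]
      by (simp add: convolution_def h) (simp add: gaussian_def)
    then have "complex_of_real (sqrt (1 / 2) ^ CARD('n)) = of_real (fourier_const TYPE('n) * (LINT y|lborel. h y))" by simp
    then have "sqrt (1 / 2) ^ CARD('n) = fourier_const TYPE('n) * (LINT y|lborel. h y)" by (simp only: of_real_eq_iff)
    then have 1: "(LINT y|lborel. h y) = K" by (simp add: K_def fourier_const_pos less_imp_neq[symmetric])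
    have \<phi>0: "\<phi> 0 = 0" "\<phi> (- y) = - \<phi> y" for y
      using \<open>linear \<phi>\<close> by (simp_all add: linear_0 linear_neg)
    have "of_real (sqrt (1 / 2) ^ CARD('n)) = complex_of_real (fourier_const TYPE('n)) * (LINT y|lborel. of_real (h (\<phi> y)))"
      using conv[of 1 0 0 0] by (simp add: convolution_def \<phi>0 h) (simp add: gaussian_def)
    then have "complex_of_real (sqrt (1 / 2) ^ CARD('n)) = of_real (fourier_const TYPE('n) * (LINT y|lborel. h (\<phi> y)))" by simp
    then have "sqrt (1 / 2) ^ CARD('n) = fourier_const TYPE('n) * (LINT y|lborel. h (\<phi> y))" by (simp only: of_real_eq_iff)
    then have 2: "(LINT y|lborel. h (B *v y)) = K" by (simp add: K_def B[symmetric] fourier_const_pos less_imp_neq[symmetric])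
    \<comment> \<open>A function that is not integrable has Bochner integral 0 by convention, so the
      nonzero value \<open>K\<close> implies integrability.\<close>
    have "integrable lborel h" "integrable lborel (\<lambda>y. h (B *v y))"
      using 1 2 K not_integrable_integral_eq by fastforce+
    then have "(\<integral>\<^sup>+y. h y \<partial>lborel) = ennreal K" "(\<integral>\<^sup>+y. h (B *v y) \<partial>lborel) = ennreal K"
      using nn_integral_eq_integral[of lborel h] nn_integral_eq_integral[of lborel "\<lambda>y. h (B *v y)"] h_nonneg
      by (simp_all add: 1 2)
    moreover have "ennreal \<bar>det B\<bar> * (\<integral>\<^sup>+y. h (B *v y) \<partial>lborel) = (\<integral>\<^sup>+y. h y \<partial>lborel)"
      using inv by (intro nn_integral_linear_change) (auto simp: invertible_det_nz)
    ultimately have "ennreal (\<bar>det B\<bar> * K) = ennreal K" using K by (simp add: ennreal_mult)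
    then show ?thesis using K by simp
  qed

  \<comment> \<open>Up to conjugation \<open>U f x\<close> is \<open>f (B *v x)\<close>, which
    decays since \<open>B\<close> is invertible. From here on inversion is available for every
    Schwartz function and not only for Gaussians.\<close>
  have U_int: "integrable lborel (U f)" if f: "f \<in> schwartz" for f
  proof -
    have "continuous_on UNIV (\<lambda>x. f (B *v x))"
      by (rule continuous_on_compose2[OF schwartz_cont[OF f]]) (auto intro: matrix_vector_mult_linear_continuous_on)
    then have i: "integrable lborel (\<lambda>x. f (B *v x))"
      by (intro decaying_integrable decaying_compose_linear schwartz_decaying f inv)
    have n: "norm (U f x) = norm (f (B *v x))" for x
      using \<phi>[of x] f by (auto simp: B)
    show ?thesis
      by (rule Bochner_Integration.integrable_bound[OF i])
         (use U_cont[OF f] in \<open>auto simp: n intro: borel_measurable_continuous_onI\<close>)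
  qed

  \<comment> \<open>Testing on an imaginary multiple of a Gaussian detects conjugation: the quotient
    is the imaginary unit or its negative. Continuity and connectedness of the space then exclude a
    change of sign.\<close>
  define \<epsilon> where "\<epsilon> x = Im (U (\<lambda>y. \<i> * ?G y) x / U ?G x)" for x
  have iG: "(\<lambda>y. \<i> * ?G y) \<in> schwartz" by (intro schwartz_scale G) simp
  have \<epsilon>_cont: "continuous_on UNIV \<epsilon>"
    unfolding \<epsilon>_def[abs_def] by (intro continuous_intros U_cont iG G) (auto simp: UG G_nz)
  have \<epsilon>1: "\<epsilon> x = 1" if "\<forall>f\<in>schwartz. U f x = f (\<phi> x)" for x
    using that iG by (simp add: \<epsilon>_def UG G_nz)
  have \<epsilon>2: "\<epsilon> x = -1" if "\<forall>f\<in>schwartz. U f x = cnj (f (\<phi> x))" for x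
    using that iG by (simp add: \<epsilon>_def UG G_nz G_cnj)
  have "(\<forall>x. \<epsilon> x = 1) \<or> (\<forall>x. \<epsilon> x = -1)"
  proof (rule ccontr)
    assume "\<not> ?thesis"
    then obtain x y where "\<epsilon> x = 1" "\<epsilon> y = -1" using \<phi> \<epsilon>1 \<epsilon>2 by metis
    then have "{-1..1} \<subseteq> range \<epsilon>"
      by (metis \<epsilon>_cont connected_UNIV connected_contains_Icc connected_continuous_image rangeI)
    then have "0 \<in> range \<epsilon>" by (rule subsetD) simp
    then obtain z where "\<epsilon> z = 0" by auto
    then show False using \<phi>[of z] \<epsilon>1[of z] \<epsilon>2[of z] by auto
  qed
  then have "(\<forall>f\<in>schwartz. U f = (\<lambda>x. f (B *v x))) \<or> (\<forall>f\<in>schwartz. U f = (\<lambda>x. cnj (f (B *v x))))"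
  proof
    assume "\<forall>x. \<epsilon> x = 1"
    then have "\<forall>f\<in>schwartz. U f x = f (\<phi> x)" for x using \<phi>[of x] \<epsilon>2[of x] by auto
    then show ?thesis by (auto simp: fun_eq_iff B)
  next
    assume "\<forall>x. \<epsilon> x = -1"
    then have "\<forall>f\<in>schwartz. U f x = cnj (f (\<phi> x))" for x using \<phi>[of x] \<epsilon>1[of x] by auto
    then show ?thesis by (auto simp: fun_eq_iff B)
  qed
  then have "(\<forall>f\<in>schwartz. T f = fourier (\<lambda>x. f (B *v x))) \<or> (\<forall>f\<in>schwartz. T f = fourier (\<lambda>x. cnj (f (B *v x))))"
    using inversion U_int by metis
  with inv det show ?thesis by blast
qed

end
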